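(* Let $R=K[x_1,\dots,x_n]$ be a polynomial ring over a field $K$. The symbolic powers of a symmetric strongly shifted ideal are symmetric strongly shifted. That is, if $I\subset R$ is symmetric strongly shifted and $m\ge1$, then both $$I^{(m)_{\mathrm{Min}}}=\bigcap_{P\in\mathrm{Min}(I)}(I^mR_P\cap R)\qquad\text{and}\qquad I^{(m)_{\mathrm{Ass}}}=\bigcap_{P\in\mathrm{Ass}(I)}(I^mR_P\cap R)$$ are symmetric strongly shifted.
   Context: $\mathfrak S_n$ acts on $R$ by permuting variables. $P_n=\{\lambda\in\mathbb Z^n: 0\le\lambda_1\le\cdots\le\lambda_n\}$, $x^\lambda=x_1^{\lambda_1}\cdots x_n^{\lambda_n}$. For an $\mathfrak S_n$-fixed monomial ideal $I$ put $P(I)=\{\lambda\in P_n: x^\lambda\in I\}$. An $\mathfrak S_n$-fixed monomial ideal $I$ is symmetric strongly shifted if for every $\lambda\in P(I)$ and $1\le i<j\le n$ with $\lambda_i<\lambda_j$ one has $x^\lambda x_i/x_j\in I$. $\mathrm{Ass}(I)$ and $\mathrm{Min}(I)$ denote the sets of associated primes and of minimal primes of $I$ (i.e. of $R/I$). All ideals $I$ considered are proper. *)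

theory Defs
  imports
    "HOL-Library.Poly_Mapping"
    "HOL-Computational_Algebra.Polynomial_Factorial"
    "HOL-Algebra.Ideal_Product"
    "HOL-Algebra.Algebraic_Closure_Type"
begin

text \<open>
  The variables are indexed by a finite linearly ordered type \<open>'n\<close>, whose elements in increasing
  order stand for \<open>1, \<dots>, n\<close>.  The polynomial ring \<open>K[x_1, \<dots>, x_n]\<close> is the type
  \<open>('n \<Rightarrow>\<^sub>0 nat) \<Rightarrow>\<^sub>0 'k\<close> of finitely supported functions from exponent vectors to the field \<open>'k\<close>
  (with convolution as multiplication); \<^const>\<open>ring_of_type_algebra\<close> turns it into a ring record.
\<close>

type_synonym ('n, 'k) mpol = "('n \<Rightarrow>\<^sub>0 nat) \<Rightarrow>\<^sub>0 'k"


section \<open>Associated and minimal primes, symbolic powers\<close>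

definition ass_primes :: "('a, 'b) ring_scheme \<Rightarrow> 'a set \<Rightarrow> 'a set set" where
  "ass_primes R I =
     {P. primeideal P R \<and> (\<exists>f \<in> carrier R. P = {r \<in> carrier R. r \<otimes>\<^bsub>R\<^esub> f \<in> I})}"

definition min_primes :: "('a, 'b) ring_scheme \<Rightarrow> 'a set \<Rightarrow> 'a set set" where
  "min_primes R I =
     {P. primeideal P R \<and> I \<subseteq> P \<and> (\<forall>Q. primeideal Q R \<and> I \<subseteq> Q \<and> Q \<subseteq> P \<longrightarrow> Q = P)}"

text \<open>The localization of a domain at a prime \<open>P\<close>, as a subring of the fraction field.\<close>

definition localization :: "'a::idom set \<Rightarrow> 'a fract ring" where
  "localization P = ring_of_type_algebra\<lparr>carrier := {Fract a s | a s. s \<notin> P}\<rparr>"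

text \<open>For an ideal \<open>J\<close>, this is \<open>J R_P \<inter> R\<close>.\<close>

definition local_contraction :: "'a::idom set \<Rightarrow> 'a set \<Rightarrow> 'a set" where
  "local_contraction P J = {f. to_fract f \<in> Idl\<^bsub>localization P\<^esub> (to_fract ` J)}"

text \<open>The \<open>m\<close>-th power of \<open>I\<close> is taken in the multiplicative monoid of all ideals.\<close>

definition symbolic_power_Min :: "'a::idom set \<Rightarrow> nat \<Rightarrow> 'a set" where
  "symbolic_power_Min I m =
     (\<Inter>P \<in> min_primes ring_of_type_algebra I.
        local_contraction P (I [^]\<^bsub>ideals_set ring_of_type_algebra\<^esub> m))"

definition symbolic_power_Ass :: "'a::idom set \<Rightarrow> nat \<Rightarrow> 'a set" where
  "symbolic_power_Ass I m =
     (\<Inter>P \<in> ass_primes ring_of_type_algebra I.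
        local_contraction P (I [^]\<^bsub>ideals_set ring_of_type_algebra\<^esub> m))"


section \<open>Symmetric strongly shifted ideals\<close>

definition x_pow :: "('n \<Rightarrow>\<^sub>0 nat) \<Rightarrow> ('n, 'k::field) mpol" where
  "x_pow \<alpha> = Poly_Mapping.single \<alpha> 1"

text \<open>
  The action \<open>x_i \<mapsto> x_(\<sigma> i)\<close>.  The coefficient of \<open>x^\<nu>\<close> in the image of \<open>f\<close> is that of
  \<open>x^(\<nu> \<circ> \<sigma>)\<close> in \<open>f\<close>; \<^const>\<open>Poly_Mapping.map_key\<close> is precomposition with an injective function.
\<close>

definition permute_vars :: "('n \<Rightarrow> 'n) \<Rightarrow> ('n, 'k::field) mpol \<Rightarrow> ('n, 'k) mpol" where
  "permute_vars \<sigma> f = Poly_Mapping.map_key (Poly_Mapping.map_key \<sigma>) f"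

lemma inj_map_key:
  assumes "bij \<sigma>"
  shows "inj (Poly_Mapping.map_key \<sigma> :: ('n \<Rightarrow>\<^sub>0 nat) \<Rightarrow> _)"
proof (rule injI)
  fix \<mu> \<nu> :: "'n \<Rightarrow>\<^sub>0 nat"
  assume eq: "Poly_Mapping.map_key \<sigma> \<mu> = Poly_Mapping.map_key \<sigma> \<nu>"
  have inj: "inj \<sigma>" and surj: "surj \<sigma>" using assms by (auto simp: bij_def)
  show "\<mu> = \<nu>"
  proof (rule poly_mapping_eqI)
    fix k
    obtain i where k: "k = \<sigma> i" using surj by auto
    show "Poly_Mapping.lookup \<mu> k = Poly_Mapping.lookup \<nu> k"
      using arg_cong[OF eq, of "\<lambda>p. Poly_Mapping.lookup p i"] inj by (simp add: k map_key.rep_eq)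
  qed
qed

lemma lookup_permute_vars:
  assumes "bij \<sigma>"
  shows "Poly_Mapping.lookup (permute_vars \<sigma> f) \<nu> = Poly_Mapping.lookup f (Poly_Mapping.map_key \<sigma> \<nu>)"
  using inj_map_key[OF assms] by (simp add: permute_vars_def map_key.rep_eq)

lemma permute_vars_variable:
  assumes "bij \<sigma>"
  shows "permute_vars \<sigma> (x_pow (Poly_Mapping.single i 1)) = x_pow (Poly_Mapping.single (\<sigma> i) 1)"
proof (rule poly_mapping_eqI)
  fix \<nu> :: "'a \<Rightarrow>\<^sub>0 nat"
  have inj: "inj \<sigma>" using assms by (simp add: bij_def)
  have "Poly_Mapping.map_key \<sigma> (Poly_Mapping.single (\<sigma> i) 1) = Poly_Mapping.single i (1::nat)"
    using inj by (intro poly_mapping_eqI) (simp add: map_key.rep_eq lookup_single inj_eq when_def)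
  then have "Poly_Mapping.single i 1 = Poly_Mapping.map_key \<sigma> \<nu> \<longleftrightarrow> Poly_Mapping.single (\<sigma> i) 1 = \<nu>"
    using inj_eq[OF inj_map_key[OF assms]] by metis
  then show "Poly_Mapping.lookup (permute_vars \<sigma> (x_pow (Poly_Mapping.single i 1))) \<nu> =
             Poly_Mapping.lookup (x_pow (Poly_Mapping.single (\<sigma> i) 1)) \<nu>"
    by (simp add: lookup_permute_vars[OF assms] x_pow_def lookup_single when_def)
qed

definition monomial_ideal :: "('n::{finite, linorder}, 'k::field) mpol set \<Rightarrow> bool" where
  "monomial_ideal I \<longleftrightarrow> (\<exists>S. I = Idl\<^bsub>ring_of_type_algebra\<^esub> (x_pow ` S))"

definition sym_fixed :: "('n::{finite, linorder}, 'k::field) mpol set \<Rightarrow> bool" where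
  "sym_fixed I \<longleftrightarrow> (\<forall>\<sigma>. bij \<sigma> \<longrightarrow> permute_vars \<sigma> ` I = I)"

definition P_of :: "('n::{finite, linorder}, 'k::field) mpol set \<Rightarrow> ('n \<Rightarrow>\<^sub>0 nat) set" where
  "P_of I = {\<alpha>. mono (Poly_Mapping.lookup \<alpha>) \<and> x_pow \<alpha> \<in> I}"

text \<open>
  All ideals are proper by convention.  The exponent subtraction below does not truncate, since
  \<open>\<alpha>_j > \<alpha>_i \<ge> 0\<close>.
\<close>

definition symmetric_strongly_shifted :: "('n::{finite, linorder}, 'k::field) mpol set \<Rightarrow> bool" where
  "symmetric_strongly_shifted I \<longleftrightarrow>
     monomial_ideal I \<and> I \<noteq> UNIV \<and> sym_fixed I \<and>
     (\<forall>\<alpha> \<in> P_of I. \<forall>i j. i < j \<and> Poly_Mapping.lookup \<alpha> i < Poly_Mapping.lookup \<alpha> j \<longrightarrow>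
        x_pow (\<alpha> + Poly_Mapping.single i 1 - Poly_Mapping.single j 1) \<in> I)"

end

theory Submission
  imports Defs "HOL-Combinatorics.Transposition"
begin

text \<open>
  A monomial ideal is the span of an upward closed set \<open>U\<close> of exponents, and its minimal and
  associated primes are generated by sets \<open>F\<close> of variables; the families of these \<open>F\<close> are closed
  under permutations.  For \<open>J = I\<^sup>m\<close>, the monomials of \<open>J R_P \<inter> R\<close> with \<open>P = (x_i | i \<in> F)\<close> are the
  \<open>x^\<alpha>\<close> with \<open>x^(\<alpha> + \<beta>) \<in> J\<close> for some \<open>\<beta>\<close> supported off \<open>F\<close>.  The exchange property passes to
  \<open>J\<close>, since a sum of exponents that is smaller at \<open>i\<close> than at \<open>j\<close> has a summand with this property.
  To exchange \<open>\<alpha>\<close> at \<open>i, j\<close> in a symbolic power, only the case \<open>i \<notin> F\<close>, \<open>j \<in> F\<close> is not immediate: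
  there one uses that \<open>\<alpha>\<close> also lies in the component of \<open>F - {j} \<union> {i}\<close>, which gives
  \<open>\<alpha> + \<beta> \<in> J\<close> with \<open>\<beta>\<close> free at \<open>j\<close>, and moves the surplus at \<open>j\<close> over to \<open>i\<close>.
\<close>


section \<open>Ideals and localizations of type-class rings\<close>

text \<open>Closure under negation is multiplication by \<open>- 1\<close>, so it is not listed
  separately.\<close>

lemma ideal_type_algebra_iff:
  fixes J :: "'a::comm_ring_1 set"
  shows "ideal J ring_of_type_algebra \<longleftrightarrow>
    0 \<in> J \<and> (\<forall>a\<in>J. \<forall>b\<in>J. a + b \<in> J) \<and> (\<forall>a\<in>J. \<forall>r. r * a \<in> J)" (is "?L \<longleftrightarrow> ?R")
proof
  assume ?L
  then interpret ideal J ring_of_type_algebra .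
  show ?R
    using additive_subgroup.zero_closed[OF is_additive_subgroup]
      additive_subgroup.a_closed[OF is_additive_subgroup] I_l_closed
    by (auto simp: ring_of_type_algebra_def)
next
  assume R: ?R
  have neg: "- a \<in> J" if "a \<in> J" for a
    using R that by (metis mult_minus1)
  interpret cring "ring_of_type_algebra :: 'a ring" by (rule cring_from_type_algebra)
  show ?L
  proof (rule idealI)
    show "ring (ring_of_type_algebra :: 'a ring)" by (rule ring_from_type_algebra)
    show "subgroup J (add_monoid ring_of_type_algebra)"
    proof (rule group.subgroupI[OF a_group])
      fix a assume "a \<in> J"
      moreover have "\<ominus>\<^bsub>ring_of_type_algebra\<^esub> a = - a"
        by (rule minus_equality) (auto simp: ring_of_type_algebra_def)
      ultimately show "inv\<^bsub>add_monoid ring_of_type_algebra\<^esub> a \<in> J"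
        using neg by (simp only: a_inv_def)
    qed (use R in \<open>auto simp: ring_of_type_algebra_def\<close>)
  qed (use R in \<open>auto simp: ring_of_type_algebra_def mult.commute\<close>)
qed

lemma primeideal_type_algebra_iff:
  fixes P :: "'a::comm_ring_1 set"
  shows "primeideal P ring_of_type_algebra \<longleftrightarrow>
    ideal P ring_of_type_algebra \<and> 1 \<notin> P \<and> (\<forall>a b. a * b \<in> P \<longrightarrow> a \<in> P \<or> b \<in> P)" (is "?L \<longleftrightarrow> ?R")
proof
  assume ?L
  then interpret primeideal P ring_of_type_algebra .
  have "1 \<notin> P"
    using one_imp_carrier I_notcarr by (auto simp: ring_of_type_algebra_def)
  then show ?R
    using I_prime is_ideal by (auto simp: ring_of_type_algebra_def)
next
  assume ?R
  then show ?L
    by (intro primeidealI cring_from_type_algebra) (auto simp: ring_of_type_algebra_def)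
qed

section \<open>Localization at a prime and contraction to the ring\<close>

lemma localization_simps [simp]:
  "carrier (localization P) = {Fract a s | a s. s \<notin> P}"
  "x \<oplus>\<^bsub>localization P\<^esub> y = x + y" "x \<otimes>\<^bsub>localization P\<^esub> y = x * y"
  "\<zero>\<^bsub>localization P\<^esub> = 0" "\<one>\<^bsub>localization P\<^esub> = 1"
  by (simp_all add: localization_def ring_of_type_algebra_def)

lemma cring_localization:
  fixes P :: "'a::idom set"
  assumes "primeideal P ring_of_type_algebra"
  shows "cring (localization P)"
proof -
  from assms have 1: "1 \<notin> P" and 0: "0 \<in> P" and prime: "a * b \<in> P \<Longrightarrow> a \<in> P \<or> b \<in> P" for a b
    by (auto simp: primeideal_type_algebra_iff ideal_type_algebra_iff)
  have add: "x + y \<in> carrier (localization P)"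
    if x: "x \<in> carrier (localization P)" and y: "y \<in> carrier (localization P)" for x y
  proof -
    from x y obtain a s b t where *: "x = Fract a s" "y = Fract b t" "s \<notin> P" "t \<notin> P" by auto
    with 0 have "s \<noteq> 0" "t \<noteq> 0" by auto
    then have "x + y = Fract (a * t + b * s) (s * t)" using * by simp
    then show ?thesis using * prime by auto
  qed
  have mult: "x * y \<in> carrier (localization P)"
    if "x \<in> carrier (localization P)" "y \<in> carrier (localization P)" for x y
    using that prime by fastforce
  have zero: "0 \<in> carrier (localization P)"
    using 1 by (auto simp: Zero_fract_def)
  have one: "1 \<in> carrier (localization P)"
    using 1 by (auto simp: One_fract_def)
  have neg: "- x \<in> carrier (localization P)" if "x \<in> carrier (localization P)" for x
    using that by simp (metis minus_fract)
  show ?thesis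
  proof (rule cringI)
    show "abelian_group (localization P)"
    proof (rule abelian_groupI)
      fix x assume "x \<in> carrier (localization P)"
      then show "\<exists>y\<in>carrier (localization P). y \<oplus>\<^bsub>localization P\<^esub> x = \<zero>\<^bsub>localization P\<^esub>"
        by (intro bexI[of _ "- x"] neg) auto
    qed (use add zero in \<open>simp_all add: add_ac del: localization_simps(1)\<close>)
    show "comm_monoid (localization P)"
      by (rule comm_monoidI) (use mult one in \<open>simp_all add: mult_ac del: localization_simps(1)\<close>)
  qed (simp add: algebra_simps)
qed

text \<open>The extension of \<open>J\<close> consists of the fractions with numerator in
  \<open>J\<close> and denominator outside \<open>P\<close>: sums are put over the product of the
  denominators, which primality keeps outside \<open>P\<close>. Equating such a fraction with
  \<open>f / 1\<close> and clearing the denominator gives the criterion.\<close>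

lemma in_local_contraction_iff:
  fixes P J :: "'a::idom set"
  assumes P: "primeideal P ring_of_type_algebra" and J: "ideal J ring_of_type_algebra"
  shows "f \<in> local_contraction P J \<longleftrightarrow> (\<exists>s. s \<notin> P \<and> s * f \<in> J)"
proof -
  interpret cring "localization P" by (rule cring_localization[OF P])
  from P have 1: "1 \<notin> P" and 0: "0 \<in> P" and prime: "a * b \<in> P \<Longrightarrow> a \<in> P \<or> b \<in> P" for a b
    by (auto simp: primeideal_type_algebra_iff ideal_type_algebra_iff)
  from J have J0: "0 \<in> J" and Jadd: "a \<in> J \<Longrightarrow> b \<in> J \<Longrightarrow> a + b \<in> J" and Jmult: "a \<in> J \<Longrightarrow> r * a \<in> J"
    for a b r by (auto simp: ideal_type_algebra_iff)
  define E where "E = {Fract a s | a s. a \<in> J \<and> s \<notin> P}"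
  have sub: "to_fract ` J \<subseteq> carrier (localization P)"
    using 1 by (auto simp: to_fract_def)
  have E_carrier: "E \<subseteq> carrier (localization P)" by (auto simp: E_def)
  have mult: "y * x \<in> E" if x: "x \<in> E" and y: "y \<in> carrier (localization P)" for x y
  proof -
    from x y obtain a s b t where *: "x = Fract a s" "y = Fract b t" "s \<notin> P" "t \<notin> P" "a \<in> J"
      by (auto simp: E_def)
    then have "y * x = Fract (b * a) (t * s)" by simp
    moreover have "b * a \<in> J" "t * s \<notin> P" using * Jmult prime by auto
    ultimately show ?thesis unfolding E_def by blast
  qed
  have E: "ideal E (localization P)"
  proof (rule idealI)
    show "ring (localization P)" by (rule ring_axioms)
    show "subgroup E (add_monoid (localization P))"
    proof (rule group.subgroupI[OF a_group])
      show "E \<noteq> {}" using 1 J0 by (auto simp: E_def)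
      fix x assume x: "x \<in> E"
      then have "x \<in> carrier (localization P)" using E_carrier by blast
      moreover from this have "- x \<in> carrier (localization P)" by simp (metis minus_fract)
      ultimately have "\<ominus>\<^bsub>localization P\<^esub> x = - x"
        by (intro minus_equality) (simp_all del: localization_simps(1))
      then have "inv\<^bsub>add_monoid (localization P)\<^esub> x = - x" by (simp add: a_inv_def)
      moreover have "- x \<in> E"
      proof -
        from x obtain a s where "x = Fract a s" "a \<in> J" "s \<notin> P" by (auto simp: E_def)
        moreover have "- a \<in> J" using Jmult[OF \<open>a \<in> J\<close>, of "- 1"] by simp
        ultimately show ?thesis by (auto simp: E_def)
      qed
      ultimately show "inv\<^bsub>add_monoid (localization P)\<^esub> x \<in> E" by simp
      fix y assume y: "y \<in> E"
      from x y obtain a s b t where *: "x = Fract a s" "y = Fract b t" "s \<notin> P" "t \<notin> P" "a \<in> J" "b \<in> J"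
        by (auto simp: E_def)
      with 0 have "s \<noteq> 0" "t \<noteq> 0" by auto
      then have "x + y = Fract (a * t + b * s) (s * t)" using * by simp
      moreover have "a * t + b * s \<in> J" "s * t \<notin> P"
        using * Jadd Jmult[of a t] Jmult[of b s] prime by (auto simp: mult.commute)
      ultimately show "x \<otimes>\<^bsub>add_monoid (localization P)\<^esub> y \<in> E" unfolding E_def by auto
    qed (use E_carrier in simp)
  qed (use mult in \<open>simp_all add: mult.commute del: localization_simps(1)\<close>)
  have "Idl\<^bsub>localization P\<^esub> (to_fract ` J) = E"
  proof (rule subset_antisym)
    have "to_fract ` J \<subseteq> E" using 1 by (auto simp: E_def to_fract_def)
    then show "Idl\<^bsub>localization P\<^esub> (to_fract ` J) \<subseteq> E" by (rule genideal_minimal[OF E])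
    interpret K: ideal "Idl\<^bsub>localization P\<^esub> (to_fract ` J)" "localization P"
      by (rule genideal_ideal[OF sub])
    show "E \<subseteq> Idl\<^bsub>localization P\<^esub> (to_fract ` J)"
    proof
      fix x assume "x \<in> E"
      then obtain a s where *: "x = Fract a s" "a \<in> J" "s \<notin> P" by (auto simp: E_def)
      then have "to_fract a \<in> Idl\<^bsub>localization P\<^esub> (to_fract ` J)"
        using genideal_self[OF sub] by auto
      moreover have "Fract 1 s \<in> carrier (localization P)" using * by auto
      ultimately have "Fract 1 s * to_fract a \<in> Idl\<^bsub>localization P\<^esub> (to_fract ` J)"
        using K.I_l_closed by fastforce
      then show "x \<in> Idl\<^bsub>localization P\<^esub> (to_fract ` J)" using * by (simp add: to_fract_def)
    qed
  qed
  then have "f \<in> local_contraction P J \<longleftrightarrow> to_fract f \<in> E" by (simp add: local_contraction_def)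
  also have "\<dots> \<longleftrightarrow> (\<exists>s. s \<notin> P \<and> s * f \<in> J)"
  proof
    assume "to_fract f \<in> E"
    then obtain a s where *: "Fract f 1 = Fract a s" "a \<in> J" "s \<notin> P" by (auto simp: E_def to_fract_def)
    moreover have "s \<noteq> 0" using * 0 by auto
    ultimately have "s * f = a" by (simp add: eq_fract mult.commute)
    then show "\<exists>s. s \<notin> P \<and> s * f \<in> J" using * by blast
  next
    assume "\<exists>s. s \<notin> P \<and> s * f \<in> J"
    then obtain s where *: "s \<notin> P" "s * f \<in> J" by blast
    then have "s \<noteq> 0" using 0 by auto
    then have "to_fract f = Fract (s * f) s" by (simp add: to_fract_def eq_fract)
    then show "to_fract f \<in> E" using * by (auto simp: E_def)
  qed
  finally show ?thesis .
qed


section \<open>Monomial ideals\<close>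

abbreviation (input) lookup where "lookup \<equiv> Poly_Mapping.lookup"
abbreviation (input) keys where "keys \<equiv> Poly_Mapping.keys"

section \<open>Supports of products and leading terms\<close>

lemma lookup_mult_keys:
  fixes f g :: "'a::monoid_add \<Rightarrow>\<^sub>0 'b::semiring_0"
  shows "lookup (f * g) k = (\<Sum>a\<in>keys f. \<Sum>b\<in>keys g. if k = a + b then lookup f a * lookup g b else 0)"
proof -
  have inner: "(\<Sum>q. lookup g q when k = l + q) = (\<Sum>b\<in>keys g. if k = l + b then lookup g b else 0)" for l
    by (subst Sum_any.expand_superset[of "keys g"]) (auto simp: when_def in_keys_iff intro!: sum.cong)
  have "lookup (f * g) k = (\<Sum>l. lookup f l * (\<Sum>b\<in>keys g. if k = l + b then lookup g b else 0))"
    by (simp add: lookup_mult inner)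
  also have "\<dots> = (\<Sum>l\<in>keys f. lookup f l * (\<Sum>b\<in>keys g. if k = l + b then lookup g b else 0))"
    by (rule Sum_any.expand_superset) (auto simp: in_keys_iff)
  also have "\<dots> = (\<Sum>a\<in>keys f. \<Sum>b\<in>keys g. if k = a + b then lookup f a * lookup g b else 0)"
    by (simp add: sum_distrib_left if_distrib cong: if_cong)
  finally show ?thesis .
qed

text \<open>The two maxima are the only pair of keys with this sum, because addition is strictly
  monotone; hence the leading terms cannot cancel.\<close>

lemma lookup_mult_Max:
  fixes f g :: "'a::{ordered_cancel_comm_monoid_add, linorder} \<Rightarrow>\<^sub>0 'b::semiring_0"
  assumes "f \<noteq> 0" "g \<noteq> 0"
  shows "lookup (f * g) (Max (keys f) + Max (keys g)) = lookup f (Max (keys f)) * lookup g (Max (keys g))"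
proof -
  define u v where "u = Max (keys f)" and "v = Max (keys g)"
  have ne: "keys f \<noteq> {}" "keys g \<noteq> {}" using assms by (auto simp: keys_eq_empty)
  have uv: "u \<in> keys f" "v \<in> keys g" using ne by (auto simp: u_def v_def)
  have eq: "u + v = a + b \<longleftrightarrow> a = u \<and> b = v" if "a \<in> keys f" "b \<in> keys g" for a b
  proof
    assume uvab: "u + v = a + b"
    have le: "a \<le> u" "b \<le> v" using that by (auto simp: u_def v_def)
    have "a = u"
    proof (rule ccontr)
      assume "a \<noteq> u"
      then have "a < u" using le by simp
      then have "a + b < u + v" using le(2) by (rule add_less_le_mono)
      then show False using uvab by simp
    qed
    then show "a = u \<and> b = v" using uvab by simp
  qed auto
  have "lookup (f * g) (u + v) = (\<Sum>a\<in>keys f. \<Sum>b\<in>keys g. if a = u \<and> b = v then lookup f a * lookup g b else 0)"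
    unfolding lookup_mult_keys by (intro sum.cong) (simp_all add: eq)
  also have "\<dots> = (\<Sum>a\<in>keys f. if a = u then lookup f u * lookup g v else 0)"
    by (intro sum.cong refl) (use uv in \<open>auto simp: sum.delta\<close>)
  also have "\<dots> = lookup f u * lookup g v" using uv by (simp add: sum.delta)
  finally show ?thesis by (simp add: u_def v_def)
qed

lemma x_pow_mult: "x_pow (\<alpha> + \<beta>) = (x_pow \<alpha> * x_pow \<beta> :: ('n, 'k::field) mpol)"
  by (simp add: x_pow_def mult_single)

lemma x_pow_0: "x_pow 0 = (1 :: ('n, 'k::field) mpol)"
  by (simp add: x_pow_def)

lemma x_pow_power: "x_pow \<alpha> ^ N = (x_pow ((\<Sum>_<N. \<alpha>)) :: ('n, 'k::field) mpol)"
  by (induction N) (simp_all add: x_pow_0 x_pow_mult add.commute)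

lemma keys_x_pow [simp]: "keys (x_pow \<alpha> :: ('n, 'k::field) mpol) = {\<alpha>}"
  by (simp add: x_pow_def)

lemma lookup_x_pow_mult:
  fixes f :: "('n, 'k::field) mpol"
  shows "lookup (x_pow \<alpha> * f) (\<alpha> + \<gamma>) = lookup f \<gamma>"
proof -
  have "lookup (x_pow \<alpha> * f) (\<alpha> + \<gamma>) = (\<Sum>b\<in>keys f. if \<gamma> = b then lookup f b else 0)"
    unfolding lookup_mult_keys keys_x_pow by (simp add: x_pow_def cong: if_cong)
  also have "\<dots> = lookup f \<gamma>" by (simp add: not_in_keys_iff_lookup_eq_zero)
  finally show ?thesis .
qed

lemma keys_x_pow_mult:
  fixes f :: "('n, 'k::field) mpol"
  shows "keys (x_pow \<alpha> * f) = (+) \<alpha> ` keys f"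
proof
  show "keys (x_pow \<alpha> * f) \<subseteq> (+) \<alpha> ` keys f"
    using keys_mult[of "x_pow \<alpha>" f] by auto
  show "(+) \<alpha> ` keys f \<subseteq> keys (x_pow \<alpha> * f)"
    by (auto simp: in_keys_iff lookup_x_pow_mult)
qed

lemma mpol_sum_monomials:
  fixes f :: "('n, 'k::field) mpol"
  shows "f = (\<Sum>\<gamma>\<in>keys f. Poly_Mapping.single 0 (lookup f \<gamma>) * x_pow \<gamma>)"
  by (rule poly_mapping_eqI)
    (auto simp: lookup_sum x_pow_def mult_single lookup_single when_def sum.delta not_in_keys_iff_lookup_eq_zero)


section \<open>Monomial ideals as spans of upward closed exponent sets\<close>

definition mon_span :: "('n \<Rightarrow>\<^sub>0 nat) set \<Rightarrow> ('n, 'k::field) mpol set" where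
  "mon_span U = {f. keys f \<subseteq> U}"

definition up_closed :: "'a::plus set \<Rightarrow> bool" where
  "up_closed U \<longleftrightarrow> (\<forall>\<alpha>\<in>U. \<forall>\<beta>. \<alpha> + \<beta> \<in> U)"

lemma up_closedD: "up_closed U \<Longrightarrow> \<alpha> \<in> U \<Longrightarrow> \<alpha> + \<beta> \<in> U"
  by (auto simp: up_closed_def)

lemma x_pow_in_mon_span [simp]: "x_pow \<alpha> \<in> mon_span U \<longleftrightarrow> \<alpha> \<in> U"
  by (simp add: mon_span_def)

lemma mon_span_eq_iff: "mon_span U = (mon_span V :: ('n, 'k::field) mpol set) \<longleftrightarrow> U = V"
  by (metis subsetI subset_antisym x_pow_in_mon_span)

lemma mon_span_subset_iff: "mon_span U \<subseteq> (mon_span V :: ('n, 'k::field) mpol set) \<longleftrightarrow> U \<subseteq> V"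
proof
  show "U \<subseteq> V" if "mon_span U \<subseteq> (mon_span V :: ('n, 'k) mpol set)"
    using that by (metis subsetD subsetI x_pow_in_mon_span)
qed (auto simp: mon_span_def)

lemma ideal_mon_span:
  assumes "up_closed U"
  shows "ideal (mon_span U :: ('n, 'k::field) mpol set) ring_of_type_algebra"
proof -
  have "keys (r * a) \<subseteq> U" if "keys a \<subseteq> U" for a r :: "('n, 'k) mpol"
    using that assms keys_mult[of r a] by (fastforce simp: up_closed_def add.commute)
  moreover have "keys (a + b) \<subseteq> U" if "keys a \<subseteq> U" "keys b \<subseteq> U" for a b :: "('n, 'k) mpol"
    using that keys_add[of a b] by blast
  ultimately show ?thesis by (simp add: ideal_type_algebra_iff mon_span_def)
qed

lemma ideal_sum:
  fixes J :: "'a::comm_ring_1 set"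
  assumes "ideal J ring_of_type_algebra" "\<And>x. x \<in> A \<Longrightarrow> f x \<in> J"
  shows "sum f A \<in> J"
  using assms(2) by (induction A rule: infinite_finite_induct) (use assms(1) in \<open>auto simp: ideal_type_algebra_iff\<close>)

text \<open>A polynomial is a combination of the monomials in its support, so inclusion of a span in
  an ideal has to be checked on monomials only.\<close>

lemma mon_span_subset_ideal:
  fixes J :: "('n, 'k::field) mpol set"
  assumes "ideal J ring_of_type_algebra" "\<And>\<alpha>. \<alpha> \<in> U \<Longrightarrow> x_pow \<alpha> \<in> J"
  shows "mon_span U \<subseteq> J"
proof
  fix f :: "('n, 'k) mpol"
  assume "f \<in> mon_span U"
  then have "(\<Sum>\<gamma>\<in>keys f. Poly_Mapping.single 0 (lookup f \<gamma>) * x_pow \<gamma>) \<in> J"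
    using assms by (intro ideal_sum) (auto simp: mon_span_def ideal_type_algebra_iff)
  then show "f \<in> J" using mpol_sum_monomials[of f] by simp
qed

lemma Idl_x_pow:
  "Idl\<^bsub>ring_of_type_algebra\<^esub> (x_pow ` S) = (mon_span {\<alpha> + \<beta> | \<alpha> \<beta>. \<alpha> \<in> S} :: ('n, 'k::field) mpol set)"
    (is "?I = mon_span ?U")
proof
  interpret cring "ring_of_type_algebra :: ('n, 'k) mpol ring" by (rule cring_from_type_algebra)
  have up: "up_closed ?U" unfolding up_closed_def using add.assoc by blast
  have "\<alpha> \<in> ?U" if "\<alpha> \<in> S" for \<alpha> using that by (metis (mono_tags, lifting) CollectI add.right_neutral)
  then show "?I \<subseteq> mon_span ?U"
    by (intro genideal_minimal ideal_mon_span up) auto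
  have sub: "x_pow ` S \<subseteq> carrier (ring_of_type_algebra :: ('n, 'k) mpol ring)"
    by (simp add: ring_of_type_algebra_def)
  have "ideal ?I ring_of_type_algebra" by (rule genideal_ideal[OF sub])
  moreover have "x_pow \<gamma> \<in> ?I" if \<gamma>: "\<gamma> \<in> ?U" for \<gamma>
  proof -
    from \<gamma> obtain \<alpha> \<beta> where "\<gamma> = \<beta> + \<alpha>" "\<alpha> \<in> S" by (auto simp: add.commute)
    moreover from this have "x_pow \<alpha> \<in> ?I" using genideal_self[OF sub] by blast
    ultimately show ?thesis
      using \<open>ideal ?I ring_of_type_algebra\<close> by (simp add: x_pow_mult ideal_type_algebra_iff)
  qed
  ultimately show "mon_span ?U \<subseteq> ?I" by (rule mon_span_subset_ideal)
qed

lemma monomial_ideal_iff: "monomial_ideal I \<longleftrightarrow> (\<exists>U. up_closed U \<and> I = mon_span U)"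
proof
  assume "monomial_ideal I"
  then obtain S where "I = Idl\<^bsub>ring_of_type_algebra\<^esub> (x_pow ` S)" by (auto simp: monomial_ideal_def)
  then have "I = mon_span {\<alpha> + \<beta> | \<alpha> \<beta>. \<alpha> \<in> S}" by (simp only: Idl_x_pow)
  moreover have "up_closed {\<alpha> + \<beta> | \<alpha> \<beta>. \<alpha> \<in> S}" unfolding up_closed_def using add.assoc by blast
  ultimately show "\<exists>U. up_closed U \<and> I = mon_span U" by blast
next
  assume "\<exists>U. up_closed U \<and> I = mon_span U"
  then obtain U where U: "up_closed U" "I = mon_span U" by blast
  have "{\<alpha> + \<beta> | \<alpha> \<beta>. \<alpha> \<in> U} = U"
    using up_closedD[OF U(1)] by (auto, metis add.right_neutral)
  then have "I = Idl\<^bsub>ring_of_type_algebra\<^esub> (x_pow ` U)" using U by (simp only: Idl_x_pow)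
  then show "monomial_ideal I" by (auto simp: monomial_ideal_def)
qed

text \<open>
  The radical of \<open>J : f\<close> is a monomial ideal if \<open>J\<close> is: modulo \<open>J\<close> we may drop the terms of \<open>f\<close> lying
  in \<open>J\<close>; then the product of the leading terms of \<open>s\<close> and \<open>f\<close> lies in \<open>J\<close>, so multiplying \<open>f\<close> by
  the leading monomial of \<open>s\<close> kills a term of \<open>f\<close> modulo \<open>J\<close>.
\<close>

lemma term_power_mult_in_mon_span:
  fixes s f :: "('n::linorder, 'k::field) mpol"
  assumes U: "up_closed U" and "s * f \<in> mon_span U" and "v \<in> keys s"
  shows "\<exists>N. x_pow v ^ N * f \<in> mon_span U"
  using assms(2,3)
proof (induction "card (keys s) + card (keys f - U)" arbitrary: s f rule: less_induct)
  case less
  let ?J = "mon_span U :: ('n, 'k) mpol set"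
  have add: "a \<in> ?J \<Longrightarrow> b \<in> ?J \<Longrightarrow> a + b \<in> ?J" and mult: "a \<in> ?J \<Longrightarrow> r * a \<in> ?J" for a b r
    using ideal_mon_span[OF U, where ?'k = 'k] by (auto simp: ideal_type_algebra_iff)
  have diff: "a - b \<in> ?J" if "a \<in> ?J" "b \<in> ?J" for a b
    using add[OF that(1) mult[OF that(2), of "- 1"]] by simp
  \<comment> \<open>\<open>p\<close> collects the terms of \<open>f\<close> outside
    \<open>?J\<close>. It agrees with \<open>f\<close> modulo \<open>?J\<close>, so
    \<open>s * p\<close> remains in \<open>?J\<close>, and the leading terms of \<open>s\<close> and
    \<open>p\<close> yield an exponent in \<open>U\<close>.\<close>
  define p where "p = (\<Sum>\<gamma>\<in>keys f - U. Poly_Mapping.single 0 (lookup f \<gamma>) * x_pow \<gamma>)"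
  have lookup_p: "lookup p \<gamma> = (if \<gamma> \<in> U then 0 else lookup f \<gamma>)" for \<gamma>
    by (auto simp: p_def lookup_sum x_pow_def mult_single lookup_single when_def sum.delta
        not_in_keys_iff_lookup_eq_zero)
  have keys_p: "keys p = keys f - U"
    by (auto simp: in_keys_iff lookup_p split: if_splits)
  have fp: "f - p \<in> ?J"
    by (auto simp: mon_span_def in_keys_iff lookup_minus lookup_p split: if_splits)
  have "s * p = s * f - s * (f - p)" by (simp add: algebra_simps)
  then have sp: "s * p \<in> ?J" using diff[OF less.prems(1) mult[OF fp]] by simp
  show ?case
  proof (cases "p = 0")
    case True
    then have "f \<in> ?J" using fp by simp
    then show ?thesis using mult by blast
  next
    case False
    have s: "s \<noteq> 0" using less.prems by auto
    define u where "u = Max (keys p)"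
    define w where "w = Max (keys s)"
    have u: "u \<in> keys p" and w: "w \<in> keys s"
      using False s by (auto simp: u_def w_def keys_eq_empty)
    have "w + u \<in> keys (s * p)"
      using lookup_mult_Max[OF s False] u w by (auto simp: in_keys_iff u_def w_def)
    then have wu: "w + u \<in> U" using sp by (auto simp: mon_span_def)
    \<comment> \<open>Multiplication by a monomial is injective on exponents and keeps
      \<open>U\<close> inside \<open>U\<close>, so the number of terms outside \<open>U\<close>
      never grows; it drops once the term at \<open>u\<close> is moved into
      \<open>U\<close>.\<close>
    have card: "card (keys (x_pow \<beta> * f) - U) \<le> card (keys f - U)"
      and card': "\<beta> + u \<in> U \<Longrightarrow> card (keys (x_pow \<beta> * f) - U) < card (keys f - U)" for \<beta>
    proof -
      have sub: "keys (x_pow \<beta> * f) - U \<subseteq> (+) \<beta> ` (keys f - U)"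
        using up_closedD[OF U] by (auto simp: keys_x_pow_mult add.commute)
      have inj: "card ((+) \<beta> ` A) = card A" for A
        by (rule card_image) (simp add: inj_on_def)
      show "card (keys (x_pow \<beta> * f) - U) \<le> card (keys f - U)"
        using card_mono[OF _ sub] inj by simp
      assume "\<beta> + u \<in> U"
      then have "keys (x_pow \<beta> * f) - U \<subseteq> (+) \<beta> ` (keys f - U - {u})" using sub by blast
      then have "card (keys (x_pow \<beta> * f) - U) \<le> card (keys f - U - {u})"
        using card_mono inj by (metis finite_Diff finite_imageI finite_keys)
      also have "\<dots> < card (keys f - U)"
        using u by (intro psubset_card_mono) (auto simp: keys_p)
      finally show "card (keys (x_pow \<beta> * f) - U) < card (keys f - U)" .
    qed
    have "s * (x_pow w * f) \<in> ?J"
      using mult[OF less.prems(1), of "x_pow w"] by (simp only: mult.left_commute[of s])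
    \<comment> \<open>The induction hypothesis applies to \<open>x_pow w * f\<close>:
      \<open>s\<close> is unchanged, and \<open>w + u \<in> U\<close> lowers the number of terms
      outside \<open>U\<close>.\<close>
    then obtain N where N: "x_pow v ^ N * (x_pow w * f) \<in> ?J"
      using less.hyps[of s "x_pow w * f"] less.prems(2) card'[OF wu] by auto
    show ?thesis
    proof (cases "w = v")
      case True
      then have "x_pow v ^ Suc N * f \<in> ?J" using N by (simp add: ac_simps)
      then show ?thesis by blast
    next
      case False
      \<comment> \<open>For \<open>w \<noteq> v\<close> the leading term of \<open>s\<close> is
        dropped. By \<open>N\<close> its product with \<open>x_pow v ^ N * f\<close> lies in
        \<open>?J\<close>, so \<open>s'\<close> still multiplies \<open>x_pow v ^ N * f\<close> into
        \<open>?J\<close>, and \<open>v\<close> remains a key of \<open>s'\<close>.\<close>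
      define s' where "s' = s - Poly_Mapping.single 0 (lookup s w) * x_pow w"
      have lookup_s': "lookup s' \<gamma> = (if \<gamma> = w then 0 else lookup s \<gamma>)" for \<gamma>
        by (auto simp: s'_def lookup_minus x_pow_def mult_single lookup_single when_def)
      have keys_s': "keys s' = keys s - {w}"
        by (auto simp: in_keys_iff lookup_s' split: if_splits)
      then have "card (keys s') < card (keys s)" using w unfolding keys_s' by (intro card_Diff1_less) auto
      moreover have "card (keys (x_pow v ^ N * f) - U) \<le> card (keys f - U)"
        unfolding x_pow_power by (rule card)
      moreover have "s' * (x_pow v ^ N * f) \<in> ?J"
      proof -
        have "s' * (x_pow v ^ N * f) =
          x_pow v ^ N * (s * f) - Poly_Mapping.single 0 (lookup s w) * (x_pow v ^ N * (x_pow w * f))"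
          by (simp add: s'_def algebra_simps)
        then show ?thesis using diff[OF mult[OF less.prems(1)] mult[OF N]] by simp
      qed
      moreover have "v \<in> keys s'" using less.prems(2) False keys_s' by simp
      ultimately obtain M where "x_pow v ^ M * (x_pow v ^ N * f) \<in> ?J"
        using less.hyps[of s' "x_pow v ^ N * f"] by auto
      then have "x_pow v ^ (M + N) * f \<in> ?J" by (simp add: power_add mult.assoc)
      then show ?thesis by blast
    qed
  qed
qed


section \<open>Primes and localizations of monomial ideals\<close>

text \<open>The exponents of the monomials in the prime ideal generated by the variables with index
  in \<open>F\<close>.\<close>

definition hit :: "'n set \<Rightarrow> ('n \<Rightarrow>\<^sub>0 nat) set" where
  "hit F = {\<alpha>. \<exists>i\<in>F. lookup \<alpha> i \<noteq> 0}"

lemma hit_add [simp]: "\<alpha> + \<beta> \<in> hit F \<longleftrightarrow> \<alpha> \<in> hit F \<or> \<beta> \<in> hit F"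
  by (auto simp: hit_def lookup_add)

lemma zero_notin_hit [simp]: "0 \<notin> hit F"
  by (simp add: hit_def)

lemma sum_in_hitD: "sum f A \<in> hit F \<Longrightarrow> \<exists>x\<in>A. f x \<in> hit F"
  by (induction A rule: infinite_finite_induct) auto

lemma single_in_hit [simp]: "Poly_Mapping.single i c \<in> hit F \<longleftrightarrow> i \<in> F \<and> c \<noteq> 0"
  by (auto simp: hit_def lookup_single when_def)

lemma hit_subset_iff: "hit F \<subseteq> hit G \<longleftrightarrow> F \<subseteq> G"
proof
  show "F \<subseteq> G" if "hit F \<subseteq> hit G"
    using that single_in_hit[of _ 1] by (metis subsetD subsetI zero_neq_one)
qed (auto simp: hit_def)

lemma up_closed_hit: "up_closed (hit F)"
  by (simp add: up_closed_def)

text \<open>If \<open>a\<close> has a term \<open>x_pow v\<close> avoiding \<open>F\<close> and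
  \<open>a * b\<close> lies in the ideal, then a power of \<open>x_pow v\<close> multiplies
  \<open>b\<close> into the ideal. That power avoids \<open>F\<close> as well, so every exponent of
  \<open>b\<close> must meet \<open>F\<close>.\<close>

lemma primeideal_hit:
  "primeideal (mon_span (hit F) :: ('n::linorder, 'k::field) mpol set) ring_of_type_algebra"
proof -
  have "b \<in> mon_span (hit F)" if ab: "a * b \<in> mon_span (hit F)" and a: "a \<notin> mon_span (hit F)"
    for a b :: "('n, 'k) mpol"
  proof -
    from a obtain v where v: "v \<in> keys a" "v \<notin> hit F" by (auto simp: mon_span_def)
    obtain N where "x_pow v ^ N * b \<in> mon_span (hit F)"
      using term_power_mult_in_mon_span[OF up_closed_hit ab v(1)] by blast
    then have "(\<Sum>_<N. v) + u \<in> hit F" if "u \<in> keys b" for u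
      using that by (auto simp: mon_span_def x_pow_power keys_x_pow_mult)
    moreover have "(\<Sum>_<N. v) \<notin> hit F" using v(2) sum_in_hitD by blast
    ultimately show ?thesis by (auto simp: mon_span_def)
  qed
  moreover have "1 \<notin> (mon_span (hit F) :: ('n, 'k) mpol set)"
    by (simp flip: x_pow_0)
  ultimately show ?thesis
    using ideal_mon_span[OF up_closed_hit] by (auto simp: primeideal_type_algebra_iff)
qed

text \<open>A monomial is a product of variables, so primality puts one of them into
  \<open>P\<close>; the induction on the total degree splits off one variable at a time.\<close>

lemma x_pow_in_primeideal_iff:
  fixes P :: "('n::finite, 'k::field) mpol set"
  assumes P: "primeideal P ring_of_type_algebra"
  shows "x_pow \<alpha> \<in> P \<longleftrightarrow> \<alpha> \<in> hit {i. x_pow (Poly_Mapping.single i 1) \<in> P}"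
proof -
  from P have 1: "1 \<notin> P" and prime: "a * b \<in> P \<Longrightarrow> a \<in> P \<or> b \<in> P"
    and mult: "a \<in> P \<Longrightarrow> r * a \<in> P" for a b r
    by (auto simp: primeideal_type_algebra_iff ideal_type_algebra_iff)
  have split: "\<alpha> = (\<alpha> - Poly_Mapping.single i 1) + Poly_Mapping.single i 1"
    if "lookup \<alpha> i \<noteq> 0" for \<alpha> :: "'n \<Rightarrow>\<^sub>0 nat" and i
    by (rule poly_mapping_eqI) (use that in \<open>auto simp: lookup_add lookup_minus lookup_single when_def\<close>)
  show ?thesis
  proof
    assume "x_pow \<alpha> \<in> P"
    then show "\<alpha> \<in> hit {i. x_pow (Poly_Mapping.single i 1) \<in> P}"
    proof (induction "\<Sum>i\<in>UNIV. lookup \<alpha> i" arbitrary: \<alpha> rule: less_induct)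
      case less
      have "\<alpha> \<noteq> 0" using less.prems 1 by (auto simp: x_pow_0)
      then obtain i where i: "lookup \<alpha> i \<noteq> 0" by (metis lookup_zero poly_mapping_eqI)
      define \<beta> where "\<beta> = \<alpha> - Poly_Mapping.single i 1"
      have \<alpha>: "\<alpha> = \<beta> + Poly_Mapping.single i 1" unfolding \<beta>_def by (rule split[OF i])
      then consider "x_pow \<beta> \<in> P" | "x_pow (Poly_Mapping.single i 1) \<in> P"
        using less.prems prime by (metis x_pow_mult)
      then show ?case
      proof cases
        case 1
        have "(\<Sum>k\<in>UNIV. lookup \<beta> k) < (\<Sum>k\<in>UNIV. lookup \<alpha> k)"
          by (rule sum_strict_mono_ex1) (auto simp: \<alpha> lookup_add intro: exI[of _ i])
        then show ?thesis using less.hyps[OF _ 1] \<alpha> by simp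
      next
        case 2
        then show ?thesis using i by (auto simp: hit_def)
      qed
    qed
  next
    assume "\<alpha> \<in> hit {i. x_pow (Poly_Mapping.single i 1) \<in> P}"
    then obtain i where "lookup \<alpha> i \<noteq> 0" "x_pow (Poly_Mapping.single i 1) \<in> P" by (auto simp: hit_def)
    then show "x_pow \<alpha> \<in> P" using split mult x_pow_mult by metis
  qed
qed

text \<open>Any prime over the ideal contains the prime generated by the variables in it, and this
  smaller prime already contains the ideal. The minimal primes therefore correspond to the minimal
  transversals \<open>F\<close> of the supports of the exponents in \<open>U\<close>.\<close>

lemma min_primes_mon_span:
  fixes U :: "('n::{finite, linorder} \<Rightarrow>\<^sub>0 nat) set"
  shows "min_primes ring_of_type_algebra (mon_span U :: ('n, 'k::field) mpol set) =
    {mon_span (hit F) | F. U \<subseteq> hit F \<and> (\<forall>G. G \<subset> F \<longrightarrow> \<not> U \<subseteq> hit G)}"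
proof (intro equalityI subsetI)
  fix P :: "('n, 'k) mpol set"
  assume P: "P \<in> min_primes ring_of_type_algebra (mon_span U)"
  then have prime: "primeideal P ring_of_type_algebra" and sub: "mon_span U \<subseteq> P"
    and min: "primeideal Q ring_of_type_algebra \<Longrightarrow> mon_span U \<subseteq> Q \<Longrightarrow> Q \<subseteq> P \<Longrightarrow> Q = P" for Q
    by (auto simp: min_primes_def)
  define F where "F = {i. x_pow (Poly_Mapping.single i 1) \<in> P}"
  have iff: "x_pow \<alpha> \<in> P \<longleftrightarrow> \<alpha> \<in> hit F" for \<alpha>
    unfolding F_def by (rule x_pow_in_primeideal_iff[OF prime])
  have U: "U \<subseteq> hit F" using sub iff by (metis subsetD subsetI x_pow_in_mon_span)
  have le: "mon_span (hit F) \<subseteq> P"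
    using prime iff by (intro mon_span_subset_ideal) (auto simp: primeideal_type_algebra_iff)
  then have eq: "mon_span (hit F) = P"
    by (intro min primeideal_hit) (simp_all add: mon_span_subset_iff U)
  moreover have "\<not> U \<subseteq> hit G" if "G \<subset> F" for G
  proof
    assume "U \<subseteq> hit G"
    moreover have "hit G \<subseteq> hit F" using that by (simp add: hit_subset_iff)
    ultimately have "mon_span (hit G) = P"
      by (intro min primeideal_hit) (simp_all add: mon_span_subset_iff flip: eq)
    then show False
      using eq that hit_subset_iff by (metis mon_span_eq_iff order_refl psubsetE)
  qed
  ultimately show "P \<in> {mon_span (hit F) | F. U \<subseteq> hit F \<and> (\<forall>G. G \<subset> F \<longrightarrow> \<not> U \<subseteq> hit G)}"
    using U by blast
next
  fix P :: "('n, 'k) mpol set"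
  assume "P \<in> {mon_span (hit F) | F. U \<subseteq> hit F \<and> (\<forall>G. G \<subset> F \<longrightarrow> \<not> U \<subseteq> hit G)}"
  then obtain F where P: "P = mon_span (hit F)" and U: "U \<subseteq> hit F"
    and min: "\<And>G. G \<subset> F \<Longrightarrow> \<not> U \<subseteq> hit G" by blast
  have "Q = P" if Q: "primeideal Q ring_of_type_algebra" "mon_span U \<subseteq> Q" "Q \<subseteq> P" for Q
  proof -
    define G where "G = {i. x_pow (Poly_Mapping.single i 1) \<in> Q}"
    have iff: "x_pow \<alpha> \<in> Q \<longleftrightarrow> \<alpha> \<in> hit G" for \<alpha>
      unfolding G_def by (rule x_pow_in_primeideal_iff[OF Q(1)])
    have "U \<subseteq> hit G" using Q(2) iff by (metis subsetD subsetI x_pow_in_mon_span)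
    moreover have "hit G \<subseteq> hit F" using Q(3) iff P by (metis subsetD subsetI x_pow_in_mon_span)
    ultimately have "G = F" using min by (auto simp: hit_subset_iff)
    then have "P \<subseteq> Q" unfolding P
      using Q(1) iff by (intro mon_span_subset_ideal) (auto simp: primeideal_type_algebra_iff)
    then show ?thesis using Q(3) by simp
  qed
  then show "P \<in> min_primes ring_of_type_algebra (mon_span U)"
    using U by (auto simp: min_primes_def P primeideal_hit mon_span_subset_iff)
qed

section \<open>Associated primes and contractions of monomial ideals\<close>

lemma mult_x_pow_in_mon_span_iff:
  fixes r :: "('n, 'k::field) mpol"
  shows "x_pow \<alpha> * r \<in> mon_span U \<longleftrightarrow> (\<forall>\<beta>\<in>keys r. \<alpha> + \<beta> \<in> U)"
  by (auto simp: mon_span_def keys_x_pow_mult)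

text \<open>Let \<open>P\<close> be the annihilator of \<open>f\<close> modulo the ideal. By
  \<open>term_power_mult_in_mon_span\<close>, a power of each monomial of an element of
  \<open>P\<close> lies in \<open>P\<close>, so the prime \<open>P\<close> is generated by
  variables. Some single term of \<open>f\<close> has the same annihilator, so \<open>f\<close> may
  be replaced by a monomial.\<close>

lemma ass_primes_mon_span:
  fixes U :: "('n::{finite, linorder} \<Rightarrow>\<^sub>0 nat) set"
  assumes U: "up_closed U"
  shows "ass_primes ring_of_type_algebra (mon_span U :: ('n, 'k::field) mpol set) =
    {mon_span (hit F) | F. \<exists>\<alpha>. \<forall>\<beta>. \<alpha> + \<beta> \<in> U \<longleftrightarrow> \<beta> \<in> hit F}"
proof (intro equalityI subsetI)
  fix P :: "('n, 'k) mpol set"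
  assume "P \<in> ass_primes ring_of_type_algebra (mon_span U)"
  then obtain f where prime: "primeideal P ring_of_type_algebra"
    and P: "r \<in> P \<longleftrightarrow> r * f \<in> mon_span U" for r
    by (auto simp: ass_primes_def ring_of_type_algebra_def)
  define F where "F = {i. x_pow (Poly_Mapping.single i 1) \<in> P}"
  have iff: "x_pow \<alpha> \<in> P \<longleftrightarrow> \<alpha> \<in> hit F" for \<alpha>
    unfolding F_def by (rule x_pow_in_primeideal_iff[OF prime])
  have "P = mon_span (hit F)"
  proof
    show "mon_span (hit F) \<subseteq> P"
      using prime iff by (intro mon_span_subset_ideal) (auto simp: primeideal_type_algebra_iff)
    show "P \<subseteq> mon_span (hit F)"
    proof
      fix g assume "g \<in> P"
      then have gf: "g * f \<in> mon_span U" using P by blast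
      have "v \<in> hit F" if v: "v \<in> keys g" for v
      proof -
        obtain N where "x_pow v ^ N * f \<in> mon_span U"
          using term_power_mult_in_mon_span[OF U gf v] by blast
        then have "(\<Sum>_<N. v) \<in> hit F" using P iff by (simp add: x_pow_power)
        then show ?thesis using sum_in_hitD by blast
      qed
      then show "g \<in> mon_span (hit F)" by (auto simp: mon_span_def)
    qed
  qed
  moreover have "\<exists>u\<in>keys f. \<forall>\<beta>. u + \<beta> \<in> U \<longrightarrow> \<beta> \<in> hit F"
  proof (rule ccontr)
    assume "\<not> ?thesis"
    \<comment> \<open>Otherwise every term of \<open>f\<close> is moved into \<open>U\<close> by a
      shift avoiding \<open>F\<close>. The sum of these shifts moves all terms at once and still
      avoids \<open>F\<close>, although its monomial annihilates \<open>f\<close> and so lies in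
      \<open>P\<close>.\<close>
    then obtain \<beta> where \<beta>: "\<And>u. u \<in> keys f \<Longrightarrow> u + \<beta> u \<in> U \<and> \<beta> u \<notin> hit F" by metis
    define \<gamma> where "\<gamma> = sum \<beta> (keys f)"
    have "\<gamma> + u \<in> U" if "u \<in> keys f" for u
    proof -
      have "\<gamma> + u = (u + \<beta> u) + sum \<beta> (keys f - {u})"
        using that by (simp add: \<gamma>_def sum.remove add_ac)
      then show ?thesis using up_closedD[OF U] \<beta>[OF that] by simp
    qed
    then have "x_pow \<gamma> * f \<in> mon_span U" by (simp add: mult_x_pow_in_mon_span_iff)
    then have "\<gamma> \<in> hit F" using iff P by blast
    then show False using \<beta> sum_in_hitD unfolding \<gamma>_def by blast
  qed
  then obtain u where "u \<in> keys f" "\<And>\<beta>. u + \<beta> \<in> U \<Longrightarrow> \<beta> \<in> hit F" by blast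
  moreover have "u + \<beta> \<in> U" if "\<beta> \<in> hit F" "u \<in> keys f" for u \<beta>
    using that iff P by (auto simp: mult_x_pow_in_mon_span_iff add.commute)
  ultimately show "P \<in> {mon_span (hit F) | F. \<exists>\<alpha>. \<forall>\<beta>. \<alpha> + \<beta> \<in> U \<longleftrightarrow> \<beta> \<in> hit F}"
    by blast
next
  fix P :: "('n, 'k) mpol set"
  assume "P \<in> {mon_span (hit F) | F. \<exists>\<alpha>. \<forall>\<beta>. \<alpha> + \<beta> \<in> U \<longleftrightarrow> \<beta> \<in> hit F}"
  then obtain F \<alpha> where P: "P = mon_span (hit F)" and "\<And>\<beta>. \<alpha> + \<beta> \<in> U \<longleftrightarrow> \<beta> \<in> hit F" by blast
  then have "r \<in> P \<longleftrightarrow> r * x_pow \<alpha> \<in> mon_span U" for r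
    unfolding mult.commute[of r] mult_x_pow_in_mon_span_iff by (auto simp: mon_span_def)
  then have "P = {r \<in> carrier ring_of_type_algebra. r \<otimes>\<^bsub>ring_of_type_algebra\<^esub> x_pow \<alpha> \<in> mon_span U}"
    by (auto simp: ring_of_type_algebra_def)
  moreover have "x_pow \<alpha> \<in> carrier (ring_of_type_algebra :: ('n, 'k) mpol ring)"
    by (simp add: ring_of_type_algebra_def)
  moreover have "primeideal P ring_of_type_algebra" unfolding P by (rule primeideal_hit)
  ultimately show "P \<in> ass_primes ring_of_type_algebra (mon_span U)"
    unfolding ass_primes_def by blast
qed

text \<open>For upward closed \<open>V\<close>, these are the exponents in the contraction of
  \<open>mon_span V\<close> from the localization at the prime of \<open>F\<close>; the shift
  \<open>\<beta>\<close> is the exponent of a monomial denominator.\<close>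

definition sat :: "'n set \<Rightarrow> ('n \<Rightarrow>\<^sub>0 nat) set \<Rightarrow> ('n \<Rightarrow>\<^sub>0 nat) set" where
  "sat F V = {\<alpha>. \<exists>\<beta>. \<beta> \<notin> hit F \<and> \<alpha> + \<beta> \<in> V}"

text \<open>A multiplier \<open>s\<close> outside the prime has a term avoiding \<open>F\<close>,
  and a power of that term can replace \<open>s\<close>. Conversely, the shifts belonging to the
  individual terms of \<open>f\<close> add up to a common one.\<close>

lemma local_contraction_mon_span:
  fixes V :: "('n::{finite, linorder} \<Rightarrow>\<^sub>0 nat) set"
  assumes V: "up_closed V"
  shows "local_contraction (mon_span (hit F)) (mon_span V) = (mon_span (sat F V) :: ('n, 'k::field) mpol set)"
proof (intro equalityI subsetI)
  fix f :: "('n, 'k) mpol"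
  assume "f \<in> local_contraction (mon_span (hit F)) (mon_span V)"
  then obtain s where s: "s \<notin> mon_span (hit F)" "s * f \<in> mon_span V"
    by (auto simp: in_local_contraction_iff[OF primeideal_hit ideal_mon_span[OF V]])
  then obtain v where v: "v \<in> keys s" "v \<notin> hit F" by (auto simp: mon_span_def)
  obtain N where "x_pow v ^ N * f \<in> mon_span V"
    using term_power_mult_in_mon_span[OF V s(2) v(1)] by blast
  then have "u + (\<Sum>_<N. v) \<in> V" if "u \<in> keys f" for u
    using that by (auto simp: x_pow_power mult_x_pow_in_mon_span_iff add.commute)
  moreover have "(\<Sum>_<N. v) \<notin> hit F" using v(2) sum_in_hitD by blast
  ultimately show "f \<in> mon_span (sat F V)" unfolding mon_span_def sat_def by blast
next
  fix f :: "('n, 'k) mpol"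
  assume "f \<in> mon_span (sat F V)"
  then have "\<forall>u\<in>keys f. \<exists>\<beta>. u + \<beta> \<in> V \<and> \<beta> \<notin> hit F" unfolding mon_span_def sat_def by blast
  then obtain \<beta> where \<beta>: "\<And>u. u \<in> keys f \<Longrightarrow> u + \<beta> u \<in> V \<and> \<beta> u \<notin> hit F" by metis
  define \<gamma> where "\<gamma> = sum \<beta> (keys f)"
  have "\<gamma> + u \<in> V" if "u \<in> keys f" for u
  proof -
    have "\<gamma> + u = (u + \<beta> u) + sum \<beta> (keys f - {u})"
      using that by (simp add: \<gamma>_def sum.remove add_ac)
    then show ?thesis using up_closedD[OF V] \<beta>[OF that] by simp
  qed
  then have "x_pow \<gamma> * f \<in> mon_span V" by (simp add: mult_x_pow_in_mon_span_iff)
  moreover have "x_pow \<gamma> \<notin> (mon_span (hit F) :: ('n, 'k) mpol set)"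
    using \<beta> sum_in_hitD unfolding \<gamma>_def x_pow_in_mon_span by blast
  ultimately show "f \<in> local_contraction (mon_span (hit F)) (mon_span V)"
    unfolding in_local_contraction_iff[OF primeideal_hit ideal_mon_span[OF V]] by blast
qed


section \<open>Permutations and exchanges\<close>

lemma map_key_inv_map_key:
  assumes "bij \<sigma>"
  shows "Poly_Mapping.map_key (inv_into UNIV \<sigma>) (Poly_Mapping.map_key \<sigma> \<alpha>) = \<alpha>"
    and "Poly_Mapping.map_key \<sigma> (Poly_Mapping.map_key (inv_into UNIV \<sigma>) \<alpha>) = \<alpha>"
  using assms
  by (auto intro!: poly_mapping_eqI simp: map_key.rep_eq bij_is_inj bij_imp_bij_inv
      surj_f_inv_f[OF bij_is_surj] inv_f_f[OF bij_is_inj])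

definition perm_closed :: "('n \<Rightarrow>\<^sub>0 nat) set \<Rightarrow> bool" where
  "perm_closed V \<longleftrightarrow> (\<forall>\<sigma>. bij \<sigma> \<longrightarrow> (\<forall>\<alpha>\<in>V. Poly_Mapping.map_key \<sigma> \<alpha> \<in> V))"

lemma perm_closedD: "perm_closed V \<Longrightarrow> bij \<sigma> \<Longrightarrow> \<alpha> \<in> V \<Longrightarrow> Poly_Mapping.map_key \<sigma> \<alpha> \<in> V"
  by (simp add: perm_closed_def)

text \<open>\<open>permute_vars \<sigma>\<close> acts on exponents by precomposition with the
  inverse of \<open>\<sigma>\<close>. Since all bijections are considered, closure under
  precomposition with \<open>\<sigma>\<close> is the same condition.\<close>

lemma sym_fixed_mon_span:
  "sym_fixed (mon_span U :: ('n::{finite, linorder}, 'k::field) mpol set) \<longleftrightarrow> perm_closed U"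
proof
  assume L: "sym_fixed (mon_span U :: ('n, 'k) mpol set)"
  have "Poly_Mapping.map_key \<sigma> \<alpha> \<in> U" if \<sigma>: "bij \<sigma>" and \<alpha>: "\<alpha> \<in> U" for \<sigma> \<alpha>
  proof -
    have bij: "bij (inv_into UNIV \<sigma>)" using \<sigma> by (rule bij_imp_bij_inv)
    have "permute_vars (inv_into UNIV \<sigma>) (x_pow \<alpha>) \<in> (mon_span U :: ('n, 'k) mpol set)"
      using L \<alpha> bij unfolding sym_fixed_def by (metis imageI x_pow_in_mon_span)
    moreover have "Poly_Mapping.map_key \<sigma> \<alpha> \<in> keys (permute_vars (inv_into UNIV \<sigma>) (x_pow \<alpha> :: ('n, 'k) mpol))"
      by (simp add: in_keys_iff lookup_permute_vars[OF bij] map_key_inv_map_key[OF \<sigma>] x_pow_def)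
    ultimately show ?thesis by (auto simp: mon_span_def)
  qed
  then show "perm_closed U" by (simp add: perm_closed_def)
next
  assume U: "perm_closed U"
  have sub: "permute_vars \<sigma> f \<in> mon_span U" if \<sigma>: "bij \<sigma>" and f: "f \<in> mon_span U"
    for \<sigma> and f :: "('n, 'k) mpol"
  proof -
    have "\<nu> \<in> U" if "\<nu> \<in> keys (permute_vars \<sigma> f)" for \<nu>
    proof -
      have "Poly_Mapping.map_key \<sigma> \<nu> \<in> U"
        using that f by (auto simp: in_keys_iff lookup_permute_vars[OF \<sigma>] mon_span_def)
      then have "Poly_Mapping.map_key (inv_into UNIV \<sigma>) (Poly_Mapping.map_key \<sigma> \<nu>) \<in> U"
        by (rule perm_closedD[OF U bij_imp_bij_inv[OF \<sigma>]])
      then show ?thesis by (simp add: map_key_inv_map_key[OF \<sigma>])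
    qed
    then show ?thesis by (auto simp: mon_span_def)
  qed
  have inv: "f = permute_vars \<sigma> (permute_vars (inv_into UNIV \<sigma>) f)" if \<sigma>: "bij \<sigma>" for \<sigma> and f :: "('n, 'k) mpol"
    by (rule poly_mapping_eqI)
      (simp add: lookup_permute_vars \<sigma> bij_imp_bij_inv map_key_inv_map_key[OF \<sigma>])
  show "sym_fixed (mon_span U :: ('n, 'k) mpol set)"
    unfolding sym_fixed_def
  proof (intro allI impI equalityI subsetI)
    fix \<sigma> :: "'n \<Rightarrow> 'n" and f :: "('n, 'k) mpol"
    assume \<sigma>: "bij \<sigma>"
    show "f \<in> mon_span U" if "f \<in> permute_vars \<sigma> ` mon_span U"
      using that sub[OF \<sigma>] by auto
    show "f \<in> permute_vars \<sigma> ` mon_span U" if "f \<in> mon_span U"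
      using inv[OF \<sigma>, of f] sub[OF bij_imp_bij_inv[OF \<sigma>] that] by blast
  qed
qed

text \<open>In contrast to the definition of symmetric strongly shifted ideals, neither sortedness
  of \<open>\<alpha>\<close> nor \<open>i < j\<close> is required. This order-free form is the one
  that passes to sums of exponents and to saturations.\<close>

definition exchange :: "('n \<Rightarrow>\<^sub>0 nat) set \<Rightarrow> bool" where
  "exchange V \<longleftrightarrow> (\<forall>\<alpha>\<in>V. \<forall>i j. lookup \<alpha> i < lookup \<alpha> j \<longrightarrow>
     \<alpha> + Poly_Mapping.single i 1 - Poly_Mapping.single j 1 \<in> V)"

text \<open>The element of \<open>'n\<close> at position \<open>p\<close> in increasing order is
  sent to the entry at position \<open>p\<close> of the list of all elements sorted by
  \<open>f\<close>.\<close>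

lemma ex_sorting_permutation:
  fixes f :: "'n::{finite, linorder} \<Rightarrow> 'a::linorder"
  shows "\<exists>\<sigma> :: 'n \<Rightarrow> 'n. bij \<sigma> \<and> mono (f \<circ> \<sigma>)"
proof -
  define xs where "xs = sorted_list_of_set (UNIV :: 'n set)"
  define ys where "ys = sort_key f xs"
  have xs: "sorted xs" "distinct xs" "set xs = UNIV" by (simp_all add: xs_def)
  have ys: "sorted (map f ys)" "distinct ys" "set ys = UNIV" "length ys = length xs"
    using xs by (simp_all add: ys_def)
  have bij_xs: "bij_betw ((!) xs) {..<length xs} UNIV"
    using xs by (intro bij_betw_nth) auto
  have bij_ys: "bij_betw ((!) ys) {..<length xs} UNIV"
    using ys by (intro bij_betw_nth) auto
  define \<sigma> where "\<sigma> = (!) ys \<circ> the_inv_into {..<length xs} ((!) xs)"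
  have bij: "bij \<sigma>" unfolding \<sigma>_def
    using bij_betw_trans[OF bij_betw_the_inv_into[OF bij_xs] bij_ys] .
  have \<sigma>: "\<sigma> (xs ! p) = ys ! p" if "p < length xs" for p
    using the_inv_into_f_f[OF bij_betw_imp_inj_on[OF bij_xs]] that by (simp add: \<sigma>_def)
  have "f (\<sigma> a) \<le> f (\<sigma> b)" if "a \<le> b" for a b
  proof -
    obtain p q where pq: "p < length xs" "q < length xs" "a = xs ! p" "b = xs ! q"
      using xs(3) by (metis UNIV_I in_set_conv_nth)
    show ?thesis
    proof (cases "p \<le> q")
      case True
      then show ?thesis using sorted_nth_mono[OF ys(1) True] pq ys by (simp add: \<sigma>)
    next
      case False
      then have "b \<le> a" using sorted_nth_mono[OF xs(1), of q p] pq by simp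
      then show ?thesis using that by simp
    qed
  qed
  then have "mono (f \<circ> \<sigma>)" by (auto intro: monoI)
  then show ?thesis using bij by blast
qed

text \<open>A permutation sorts \<open>\<alpha>\<close>, the exchange takes place at the preimages
  of \<open>i\<close> and \<open>j\<close>, and the inverse permutation carries the result
  back.\<close>

lemma exchange_if_sorted_exchange:
  fixes U :: "('n::{finite, linorder} \<Rightarrow>\<^sub>0 nat) set"
  assumes perm: "perm_closed U"
    and sorted: "\<And>\<alpha> i j. \<alpha> \<in> U \<Longrightarrow> mono (lookup \<alpha>) \<Longrightarrow> i < j \<Longrightarrow> lookup \<alpha> i < lookup \<alpha> j \<Longrightarrow>
      \<alpha> + Poly_Mapping.single i 1 - Poly_Mapping.single j 1 \<in> U"
  shows "exchange U"
  unfolding exchange_def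
proof (intro ballI allI impI)
  fix \<alpha> i j
  assume \<alpha>: "\<alpha> \<in> U" and ij: "lookup \<alpha> i < lookup \<alpha> j"
  obtain \<sigma> :: "'n \<Rightarrow> 'n" where \<sigma>: "bij \<sigma>" "mono (lookup \<alpha> \<circ> \<sigma>)" using ex_sorting_permutation by blast
  define \<mu> where "\<mu> = Poly_Mapping.map_key \<sigma> \<alpha>"
  have lookup: "lookup \<mu> k = lookup \<alpha> (\<sigma> k)" for k
    using \<sigma>(1) by (simp add: \<mu>_def map_key.rep_eq bij_is_inj)
  have mono: "mono (lookup \<mu>)" using \<sigma>(2) by (simp add: lookup mono_def)
  define p q where "p = inv_into UNIV \<sigma> i" and "q = inv_into UNIV \<sigma> j"
  have pq: "\<sigma> p = i" "\<sigma> q = j"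
    using \<sigma>(1) by (simp_all add: p_def q_def surj_f_inv_f[OF bij_is_surj])
  have less: "lookup \<mu> p < lookup \<mu> q" using ij by (simp add: lookup pq)
  \<comment> \<open>For a sorted exponent, a strict inequality of values forces the order of the
    positions that the sorted exchange asks for.\<close>
  then have "p < q" using mono by (meson leD leI monoD)
  then have "\<mu> + Poly_Mapping.single p 1 - Poly_Mapping.single q 1 \<in> U"
    using sorted mono less perm_closedD[OF perm \<sigma>(1) \<alpha>] by (simp add: \<mu>_def)
  then have "Poly_Mapping.map_key (inv_into UNIV \<sigma>) (\<mu> + Poly_Mapping.single p 1 - Poly_Mapping.single q 1) \<in> U"
    by (rule perm_closedD[OF perm bij_imp_bij_inv[OF \<sigma>(1)]])
  also have "Poly_Mapping.map_key (inv_into UNIV \<sigma>) (\<mu> + Poly_Mapping.single p 1 - Poly_Mapping.single q 1) =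
      \<alpha> + Poly_Mapping.single i 1 - Poly_Mapping.single j 1"
  proof (rule poly_mapping_eqI)
    fix k
    have "\<sigma> (inv_into UNIV \<sigma> k) = k" "p = inv_into UNIV \<sigma> k \<longleftrightarrow> i = k" "q = inv_into UNIV \<sigma> k \<longleftrightarrow> j = k"
      using \<sigma>(1) pq by (auto simp: surj_f_inv_f[OF bij_is_surj] p_def q_def dest: arg_cong[of _ _ \<sigma>])
    then show "lookup (Poly_Mapping.map_key (inv_into UNIV \<sigma>) (\<mu> + Poly_Mapping.single p 1 - Poly_Mapping.single q 1)) k =
        lookup (\<alpha> + Poly_Mapping.single i 1 - Poly_Mapping.single j 1) k"
      using \<sigma>(1)
      by (simp add: map_key.rep_eq bij_is_inj bij_imp_bij_inv lookup_minus lookup_add lookup lookup_single when_def)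
  qed
  finally show "\<alpha> + Poly_Mapping.single i 1 - Poly_Mapping.single j 1 \<in> U" .
qed

text \<open>
  Single exchanges reach the midpoint between \<open>\<alpha>\<close> and its image under the transposition of \<open>i\<close>
  and \<open>j\<close>; the remaining values of \<open>t\<close> follow by symmetry.
\<close>

lemma exchange_multiple:
  assumes exch: "exchange V" and perm: "perm_closed V" and \<alpha>: "\<alpha> \<in> V"
    and t: "lookup \<alpha> i + t \<le> lookup \<alpha> j"
  shows "\<alpha> + Poly_Mapping.single i t - Poly_Mapping.single j t \<in> V"
proof (cases "i = j")
  case True
  then show ?thesis using \<alpha> by simp
next
  case False
  \<comment> \<open>The bound says exactly that before the last of the \<open>t\<close> single
    exchanges the value at \<open>i\<close> is still below the value at \<open>j\<close>.\<close>
  have half: "\<alpha> + Poly_Mapping.single i t - Poly_Mapping.single j t \<in> V"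
    if "lookup \<alpha> i + 2 * t \<le> lookup \<alpha> j + 1" for t
    using that
  proof (induction t)
    case 0
    then show ?case using \<alpha> by simp
  next
    case (Suc t)
    let ?\<beta> = "\<alpha> + Poly_Mapping.single i t - Poly_Mapping.single j t"
    have "?\<beta> \<in> V" using Suc by simp
    moreover have "lookup ?\<beta> i < lookup ?\<beta> j"
      using Suc.prems False by (simp add: lookup_add lookup_minus lookup_single when_def)
    ultimately have "?\<beta> + Poly_Mapping.single i 1 - Poly_Mapping.single j 1 \<in> V"
      using exch by (auto simp: exchange_def)
    also have "?\<beta> + Poly_Mapping.single i 1 - Poly_Mapping.single j 1 =
        \<alpha> + Poly_Mapping.single i (Suc t) - Poly_Mapping.single j (Suc t)"
      by (rule poly_mapping_eqI)
        (use Suc.prems False in \<open>simp add: lookup_add lookup_minus lookup_single when_def\<close>)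
    finally show ?case .
  qed
  show ?thesis
  proof (cases "lookup \<alpha> i + 2 * t \<le> lookup \<alpha> j + 1")
    case True
    then show ?thesis by (rule half)
  next
    case large: False
    \<comment> \<open>Exchanging \<open>d\<close> units leaves \<open>lookup \<alpha> i + t\<close>
      at \<open>j\<close> and \<open>lookup \<alpha> j - t\<close> at \<open>i\<close>, so the
      transposition gives the exchange of \<open>t\<close> units. As \<open>t\<close> exceeds the
      range of \<open>half\<close>, \<open>d\<close> falls within it.\<close>
    define d where "d = lookup \<alpha> j - lookup \<alpha> i - t"
    have "\<alpha> + Poly_Mapping.single i d - Poly_Mapping.single j d \<in> V"
      using large t by (intro half) (simp add: d_def)
    then have "Poly_Mapping.map_key (transpose i j) (\<alpha> + Poly_Mapping.single i d - Poly_Mapping.single j d) \<in> V"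
      by (intro perm_closedD[OF perm]) simp_all
    also have "Poly_Mapping.map_key (transpose i j) (\<alpha> + Poly_Mapping.single i d - Poly_Mapping.single j d) =
        \<alpha> + Poly_Mapping.single i t - Poly_Mapping.single j t"
      by (rule poly_mapping_eqI)
        (use t large False in \<open>auto simp: map_key.rep_eq lookup_add lookup_minus lookup_single when_def
          transpose_def d_def\<close>)
    finally show ?thesis .
  qed
qed

section \<open>Sums of exponent sets and powers of ideals\<close>

definition exps_sum :: "('n \<Rightarrow>\<^sub>0 nat) set \<Rightarrow> ('n \<Rightarrow>\<^sub>0 nat) set \<Rightarrow> ('n \<Rightarrow>\<^sub>0 nat) set" where
  "exps_sum U V = {\<alpha> + \<beta> | \<alpha> \<beta>. \<alpha> \<in> U \<and> \<beta> \<in> V}"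

lemma up_closed_exps_sum: "up_closed U \<Longrightarrow> up_closed (exps_sum V U)"
  unfolding up_closed_def exps_sum_def by (auto simp: add.assoc) blast

lemma perm_closed_exps_sum:
  assumes "perm_closed U" "perm_closed V"
  shows "perm_closed (exps_sum U V)"
  using assms unfolding perm_closed_def exps_sum_def
  by (auto simp: map_key_plus[OF bij_is_inj]) blast

lemma exchange_exps_sum:
  assumes "exchange U" "exchange V"
  shows "exchange (exps_sum U V)"
  unfolding exchange_def
proof (intro ballI allI impI)
  fix \<gamma> i j
  assume "\<gamma> \<in> exps_sum U V" and less: "lookup \<gamma> i < lookup \<gamma> j"
  then obtain \<alpha> \<beta> where \<gamma>: "\<gamma> = \<alpha> + \<beta>" and "\<alpha> \<in> U" "\<beta> \<in> V" by (auto simp: exps_sum_def)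
  \<comment> \<open>Subtraction of exponents truncates; since \<open>\<mu>\<close> is positive at
    \<open>j\<close>, the unit can be taken from \<open>\<mu>\<close> alone.\<close>
  have move: "\<mu> + \<nu> + Poly_Mapping.single i 1 - Poly_Mapping.single j 1 =
      (\<mu> + Poly_Mapping.single i 1 - Poly_Mapping.single j 1) + \<nu>"
    if "lookup \<mu> i < lookup \<mu> j" for \<mu> \<nu> :: "'a \<Rightarrow>\<^sub>0 nat"
    by (rule poly_mapping_eqI) (use that in \<open>auto simp: lookup_add lookup_minus lookup_single when_def\<close>)
  have "lookup \<alpha> i < lookup \<alpha> j \<or> lookup \<beta> i < lookup \<beta> j"
    using less by (auto simp: \<gamma> lookup_add)
  then show "\<gamma> + Poly_Mapping.single i 1 - Poly_Mapping.single j 1 \<in> exps_sum U V"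
  proof
    assume *: "lookup \<alpha> i < lookup \<alpha> j"
    then have "\<alpha> + Poly_Mapping.single i 1 - Poly_Mapping.single j 1 \<in> U"
      using assms(1) \<open>\<alpha> \<in> U\<close> by (auto simp: exchange_def)
    then show ?thesis unfolding \<gamma> move[OF *] using \<open>\<beta> \<in> V\<close> by (auto simp: exps_sum_def)
  next
    assume *: "lookup \<beta> i < lookup \<beta> j"
    then have "\<beta> + Poly_Mapping.single i 1 - Poly_Mapping.single j 1 \<in> V"
      using assms(2) \<open>\<beta> \<in> V\<close> by (auto simp: exchange_def)
    moreover have "\<gamma> + Poly_Mapping.single i 1 - Poly_Mapping.single j 1 =
        \<alpha> + (\<beta> + Poly_Mapping.single i 1 - Poly_Mapping.single j 1)"
      using move[OF *, of \<alpha>] by (simp add: \<gamma> add.commute)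
    ultimately show ?thesis using \<open>\<alpha> \<in> U\<close> by (auto simp: exps_sum_def)
  qed
qed

lemma ideal_prod_mon_span:
  assumes U: "up_closed U" and V: "up_closed V"
  shows "ideal_prod ring_of_type_algebra (mon_span U) (mon_span V) =
    (mon_span (exps_sum U V) :: ('n, 'k::field) mpol set)" (is "?P = _")
proof
  interpret cring "ring_of_type_algebra :: ('n, 'k) mpol ring" by (rule cring_from_type_algebra)
  have "ideal ?P ring_of_type_algebra"
    by (intro ideal_prod_is_ideal ideal_mon_span assms)
  moreover have "x_pow \<gamma> \<in> ?P" if \<gamma>: "\<gamma> \<in> exps_sum U V" for \<gamma>
  proof -
    from \<gamma> obtain \<alpha> \<beta> where "\<gamma> = \<alpha> + \<beta>" "\<alpha> \<in> U" "\<beta> \<in> V" by (auto simp: exps_sum_def)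
    then show ?thesis
      using ideal_prod.prod[of "x_pow \<alpha>" "mon_span U" "x_pow \<beta>" "mon_span V" "ring_of_type_algebra"]
      by (simp add: x_pow_mult) (simp add: ring_of_type_algebra_def)
  qed
  ultimately show "mon_span (exps_sum U V) \<subseteq> ?P" by (rule mon_span_subset_ideal)
  have "f \<in> mon_span (exps_sum U V)" if "f \<in> ?P" for f
    using that
  proof (induction rule: ideal_prod.induct)
    case (prod a b)
    then show ?case
      using keys_mult[of a b] by (fastforce simp: mon_span_def exps_sum_def ring_of_type_algebra_def)
  next
    case (sum a b)
    then show ?case
      using keys_add[of a b] by (fastforce simp: mon_span_def ring_of_type_algebra_def)
  qed
  then show "?P \<subseteq> mon_span (exps_sum U V)" by blast
qed

text \<open>The exponent set of a power is an iterated sum of copies of \<open>U\<close>, to which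
  all three closure properties pass. The inclusion in \<open>U\<close> serves to prove that the
  symbolic powers are proper; for \<open>m = 0\<close> the power is the whole ring.\<close>

lemma ideal_power_mon_span:
  fixes U :: "('n \<Rightarrow>\<^sub>0 nat) set" and m :: nat
  assumes U: "up_closed U" "perm_closed U" "exchange U"
  shows "\<exists>V. mon_span U [^]\<^bsub>ideals_set ring_of_type_algebra\<^esub> m = (mon_span V :: ('n, 'k::field) mpol set) \<and>
    up_closed V \<and> perm_closed V \<and> exchange V \<and> (m \<ge> 1 \<longrightarrow> V \<subseteq> U)"
proof (induction m)
  case 0
  have "mon_span U [^]\<^bsub>ideals_set ring_of_type_algebra\<^esub> (0::nat) = (mon_span UNIV :: ('n, 'k) mpol set)"
    by (simp add: nat_pow_def ideals_set_def ring_of_type_algebra_def mon_span_def)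
  moreover have "up_closed (UNIV :: ('n \<Rightarrow>\<^sub>0 nat) set)" "perm_closed (UNIV :: ('n \<Rightarrow>\<^sub>0 nat) set)"
    "exchange (UNIV :: ('n \<Rightarrow>\<^sub>0 nat) set)"
    by (simp_all add: up_closed_def perm_closed_def exchange_def)
  ultimately show ?case by force
next
  case (Suc m)
  then obtain V where V: "mon_span U [^]\<^bsub>ideals_set ring_of_type_algebra\<^esub> m = (mon_span V :: ('n, 'k) mpol set)"
    "up_closed V" "perm_closed V" "exchange V" by blast
  have "mon_span U [^]\<^bsub>ideals_set ring_of_type_algebra\<^esub> Suc m =
      ideal_prod ring_of_type_algebra (mon_span U [^]\<^bsub>ideals_set ring_of_type_algebra\<^esub> m) (mon_span U :: ('n, 'k) mpol set)"
    by (simp add: nat_pow_def ideals_set_def)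
  also have "\<dots> = mon_span (exps_sum V U)" by (simp add: V ideal_prod_mon_span U)
  finally have "mon_span U [^]\<^bsub>ideals_set ring_of_type_algebra\<^esub> Suc m = (mon_span (exps_sum V U) :: ('n, 'k) mpol set)" .
  moreover have "exps_sum V U \<subseteq> U"
    by (auto simp: exps_sum_def) (metis add.commute up_closedD[OF U(1)])
  ultimately show ?case
    using U V by (intro exI[of _ "exps_sum V U"])
      (simp add: up_closed_exps_sum perm_closed_exps_sum exchange_exps_sum)
qed


section \<open>Symbolic powers\<close>

lemma perm_closed_iff: "perm_closed U \<Longrightarrow> bij \<sigma> \<Longrightarrow> Poly_Mapping.map_key \<sigma> \<alpha> \<in> U \<longleftrightarrow> \<alpha> \<in> U"
  by (metis perm_closedD bij_imp_bij_inv map_key_inv_map_key(1))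

lemma map_key_in_hit_iff: "inj \<sigma> \<Longrightarrow> Poly_Mapping.map_key \<sigma> \<alpha> \<in> hit F \<longleftrightarrow> \<alpha> \<in> hit (\<sigma> ` F)"
  by (simp add: hit_def map_key.rep_eq)

lemma subset_hit_image:
  assumes "perm_closed U" "bij \<sigma>" "U \<subseteq> hit F"
  shows "U \<subseteq> hit (\<sigma> ` F)"
  using assms perm_closed_iff[OF assms(1,2)] map_key_in_hit_iff[OF bij_is_inj[OF assms(2)]] by blast

text \<open>The inverse permutation would carry a smaller transversal back to one properly contained
  in \<open>F\<close>.\<close>

lemma minimal_transversal_image:
  assumes "perm_closed U" "bij \<sigma>" "U \<subseteq> hit F" and min: "\<And>G. G \<subset> F \<Longrightarrow> \<not> U \<subseteq> hit G" and G: "G \<subset> \<sigma> ` F"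
  shows "\<not> U \<subseteq> hit G"
proof
  assume "U \<subseteq> hit G"
  then have "U \<subseteq> hit (inv_into UNIV \<sigma> ` G)"
    by (rule subset_hit_image[OF assms(1) bij_imp_bij_inv[OF assms(2)]])
  moreover have "inv_into UNIV \<sigma> ` G \<subset> F"
  proof -
    have F: "inv_into UNIV \<sigma> ` \<sigma> ` F = F"
      using assms(2) by (simp add: bij_is_inj image_inv_f_f)
    have "inj (inv_into UNIV \<sigma>)"
      using assms(2) by (simp add: bij_imp_bij_inv bij_is_inj)
    then have "inv_into UNIV \<sigma> ` G \<subset> inv_into UNIV \<sigma> ` \<sigma> ` F"
      using G by (meson image_strict_mono inj_on_subset subset_UNIV)
    then show ?thesis by (simp only: F)
  qed
  ultimately show False using min by blast
qed

text \<open>Among the exponents outside \<open>sat F U\<close>, one of maximal degree in the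
  variables of \<open>F\<close> is chosen. Multiplying it by any variable of \<open>F\<close> leads
  into \<open>sat F U\<close>; adding the shifts needed for all these variables gives a monomial
  whose annihilator is the prime of \<open>F\<close>. This is the fact that minimal primes are
  associated.\<close>

lemma minimal_transversal_witness:
  fixes U :: "('n::finite \<Rightarrow>\<^sub>0 nat) set"
  assumes up: "up_closed U" and hit: "U \<subseteq> hit F" and min: "\<And>G. G \<subset> F \<Longrightarrow> \<not> U \<subseteq> hit G"
  shows "\<exists>\<alpha>. \<forall>\<beta>. \<alpha> + \<beta> \<in> U \<longleftrightarrow> \<beta> \<in> hit F"
proof -
  have "\<exists>\<gamma>\<in>U. \<gamma> \<notin> hit (F - {i})" if "i \<in> F" for i
    using min[of "F - {i}"] that by blast
  \<comment> \<open>\<open>\<gamma> i\<close> meets \<open>F\<close> because it lies in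
    \<open>U\<close>, and by minimality of \<open>F\<close> it can be chosen to do so at
    \<open>i\<close> only.\<close>
  then obtain \<gamma> where \<gamma>: "\<And>i. i \<in> F \<Longrightarrow> \<gamma> i \<in> U \<and> \<gamma> i \<notin> hit (F - {i})" by metis
  \<comment> \<open>\<open>A\<close> is the complement of \<open>sat F U\<close>.\<close>
  define A where "A = {\<alpha>. \<forall>\<beta>. \<beta> \<notin> hit F \<longrightarrow> \<alpha> + \<beta> \<notin> U}"
  have 0: "0 \<in> A" using hit by (auto simp: A_def)
  \<comment> \<open>Otherwise \<open>\<gamma> i\<close> with its entry at \<open>i\<close> removed
    is a shift avoiding \<open>F\<close> that moves \<open>\<alpha>\<close> into \<open>U\<close>.
    The resulting bound makes a maximal degree over \<open>F\<close> exist on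
    \<open>A\<close>.\<close>
  have less: "lookup \<alpha> i < lookup (\<gamma> i) i" if "\<alpha> \<in> A" "i \<in> F" for \<alpha> i
  proof (rule ccontr)
    assume ge: "\<not> lookup \<alpha> i < lookup (\<gamma> i) i"
    define \<beta> where "\<beta> = \<gamma> i - Poly_Mapping.single i (lookup (\<gamma> i) i)"
    have "\<beta> \<notin> hit F"
      using \<gamma>[OF that(2)] by (auto simp: \<beta>_def hit_def lookup_minus lookup_single when_def)
    moreover have "\<alpha> + \<beta> = \<gamma> i + (\<alpha> - Poly_Mapping.single i (lookup (\<gamma> i) i))"
      by (rule poly_mapping_eqI)
        (use ge in \<open>auto simp: \<beta>_def lookup_add lookup_minus lookup_single when_def\<close>)
    then have "\<alpha> + \<beta> \<in> U" using up_closedD[OF up] \<gamma>[OF that(2)] by simp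
    ultimately show False using that(1) by (auto simp: A_def)
  qed
  have "(\<Sum>i\<in>F. lookup \<alpha> i) \<le> (\<Sum>i\<in>F. lookup (\<gamma> i) i)" if "\<alpha> \<in> A" for \<alpha>
    by (intro sum_mono less_imp_le less that)
  then have "\<exists>\<alpha>. \<alpha> \<in> A \<and> (\<forall>\<mu>. \<mu> \<in> A \<longrightarrow> (\<Sum>i\<in>F. lookup \<mu> i) \<le> (\<Sum>i\<in>F. lookup \<alpha> i))"
    using 0 by (intro ex_has_greatest_nat[of _ 0 _ "Suc (\<Sum>i\<in>F. lookup (\<gamma> i) i)"])
      (auto simp: less_Suc_eq_le)
  then obtain \<alpha> where \<alpha>: "\<alpha> \<in> A" and max: "\<And>\<mu>. \<mu> \<in> A \<Longrightarrow> (\<Sum>i\<in>F. lookup \<mu> i) \<le> (\<Sum>i\<in>F. lookup \<alpha> i)"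
    by blast
  have "\<exists>\<delta>. \<delta> \<notin> hit F \<and> \<alpha> + Poly_Mapping.single i 1 + \<delta> \<in> U" if "i \<in> F" for i
  proof -
    have "(\<Sum>k\<in>F. lookup (\<alpha> + Poly_Mapping.single i 1) k) > (\<Sum>k\<in>F. lookup \<alpha> k)"
      using that by (intro sum_strict_mono_ex1) (auto simp: lookup_add intro!: bexI[of _ i])
    then have "\<alpha> + Poly_Mapping.single i 1 \<notin> A" using max leD by blast
    then show ?thesis by (auto simp: A_def)
  qed
  then obtain \<delta> where \<delta>: "\<And>i. i \<in> F \<Longrightarrow> \<delta> i \<notin> hit F \<and> \<alpha> + Poly_Mapping.single i 1 + \<delta> i \<in> U" by metis
  \<comment> \<open>The shifts \<open>\<delta> i\<close> avoid \<open>F\<close>, so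
    \<open>\<alpha> \<in> A\<close> still forces \<open>\<beta>\<close> to meet \<open>F\<close>;
    when \<open>\<beta>\<close> is positive at \<open>i\<close>, the summand
    \<open>\<delta> i\<close> is enough to enter \<open>U\<close>.\<close>
  have "(\<alpha> + sum \<delta> F) + \<beta> \<in> U \<longleftrightarrow> \<beta> \<in> hit F" for \<beta>
  proof
    assume "(\<alpha> + sum \<delta> F) + \<beta> \<in> U"
    then have "sum \<delta> F + \<beta> \<in> hit F" using \<alpha> unfolding A_def add.assoc by blast
    then show "\<beta> \<in> hit F" using \<delta> sum_in_hitD by fastforce
  next
    assume "\<beta> \<in> hit F"
    then obtain i where i: "i \<in> F" "lookup \<beta> i \<noteq> 0" by (auto simp: hit_def)
    have "\<beta> = Poly_Mapping.single i 1 + (\<beta> - Poly_Mapping.single i 1)"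
      by (rule poly_mapping_eqI) (use i in \<open>auto simp: lookup_add lookup_minus lookup_single when_def\<close>)
    moreover have "sum \<delta> F = \<delta> i + sum \<delta> (F - {i})" using i by (simp add: sum.remove)
    ultimately have "(\<alpha> + sum \<delta> F) + \<beta> =
        (\<alpha> + Poly_Mapping.single i 1 + \<delta> i) + (sum \<delta> (F - {i}) + (\<beta> - Poly_Mapping.single i 1))"
      by (metis (no_types, lifting) add.assoc add.left_commute)
    then show "(\<alpha> + sum \<delta> F) + \<beta> \<in> U" using up_closedD[OF up] \<delta>[OF i(1)] by simp
  qed
  then show ?thesis by blast
qed

section \<open>Intersections of saturations over a permutation-invariant family\<close>

lemma up_closed_sat:
  assumes "up_closed V"
  shows "up_closed (sat F V)"
  unfolding up_closed_def
proof (intro ballI allI)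
  fix \<alpha> \<gamma> assume "\<alpha> \<in> sat F V"
  then obtain \<beta> where "\<beta> \<notin> hit F" "\<alpha> + \<beta> \<in> V" by (auto simp: sat_def)
  moreover have "\<alpha> + \<gamma> + \<beta> = (\<alpha> + \<beta>) + \<gamma>" by (simp add: add_ac)
  ultimately have "\<alpha> + \<gamma> + \<beta> \<in> V" using up_closedD[OF assms] by metis
  then show "\<alpha> + \<gamma> \<in> sat F V" using \<open>\<beta> \<notin> hit F\<close> by (auto simp: sat_def)
qed

lemma up_closed_INT_sat: "up_closed V \<Longrightarrow> up_closed (\<Inter>F\<in>\<F>. sat F V)"
  using up_closed_sat by (fastforce simp: up_closed_def)

text \<open>For the component of \<open>F\<close>, the permuted exponent inherits a shift from the
  component of the image of \<open>F\<close> under \<open>\<sigma>\<close>, which is again in the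
  family.\<close>

lemma perm_closed_INT_sat:
  assumes V: "perm_closed V" and \<F>: "\<And>F \<sigma>. F \<in> \<F> \<Longrightarrow> bij \<sigma> \<Longrightarrow> \<sigma> ` F \<in> \<F>"
  shows "perm_closed (\<Inter>F\<in>\<F>. sat F V)"
  unfolding perm_closed_def
proof (intro allI impI ballI INT_I)
  fix \<sigma> :: "'a \<Rightarrow> 'a" and \<alpha> F
  assume \<sigma>: "bij \<sigma>" and \<alpha>: "\<alpha> \<in> (\<Inter>F\<in>\<F>. sat F V)" and "F \<in> \<F>"
  then have "\<alpha> \<in> sat (\<sigma> ` F) V" using \<F> by blast
  then obtain \<beta> where \<beta>: "\<beta> \<notin> hit (\<sigma> ` F)" "\<alpha> + \<beta> \<in> V" by (auto simp: sat_def)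
  have inj: "inj \<sigma>" using \<sigma> by (rule bij_is_inj)
  have "Poly_Mapping.map_key \<sigma> \<beta> \<notin> hit F" using \<beta> by (simp add: map_key_in_hit_iff[OF inj])
  moreover have "Poly_Mapping.map_key \<sigma> \<alpha> + Poly_Mapping.map_key \<sigma> \<beta> \<in> V"
    using perm_closedD[OF V \<sigma> \<beta>(2)] by (simp add: map_key_plus[OF inj])
  ultimately show "Poly_Mapping.map_key \<sigma> \<alpha> \<in> sat F V" by (auto simp: sat_def)
qed

lemma exchange_INT_sat:
  assumes V: "up_closed V" "perm_closed V" "exchange V"
    and \<F>: "\<And>F \<sigma>. F \<in> \<F> \<Longrightarrow> bij \<sigma> \<Longrightarrow> \<sigma> ` F \<in> \<F>"
  shows "exchange (\<Inter>F\<in>\<F>. sat F V)"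
  unfolding exchange_def
proof (intro ballI allI impI INT_I)
  fix \<alpha> i j F
  assume \<alpha>: "\<alpha> \<in> (\<Inter>F\<in>\<F>. sat F V)" and less: "lookup \<alpha> i < lookup \<alpha> j" and F: "F \<in> \<F>"
  from less have ij: "i \<noteq> j" by auto
  from \<alpha> F obtain \<beta> where \<beta>: "\<beta> \<notin> hit F" "\<alpha> + \<beta> \<in> V" by (auto simp: sat_def)
  let ?\<alpha>' = "\<alpha> + Poly_Mapping.single i 1 - Poly_Mapping.single j 1"
  consider (outside) "j \<notin> F" | (inside) "i \<in> F" "j \<in> F" | (mixed) "i \<notin> F" "j \<in> F" by blast
  then have "\<exists>\<delta>. \<delta> \<notin> hit F \<and> ?\<alpha>' + \<delta> \<in> V"
  proof cases
    case outside
    \<comment> \<open>The variable at \<open>j\<close> is invertible in this localization, so the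
      shift may give back the unit that was taken from \<open>\<alpha>\<close>.\<close>
    have "?\<alpha>' + (\<beta> + Poly_Mapping.single j 1) = (\<alpha> + \<beta>) + Poly_Mapping.single i 1"
      by (rule poly_mapping_eqI)
        (use ij less in \<open>auto simp: lookup_add lookup_minus lookup_single when_def\<close>)
    moreover have "\<beta> + Poly_Mapping.single j 1 \<notin> hit F" using \<beta>(1) outside by simp
    ultimately show ?thesis using up_closedD[OF V(1) \<beta>(2)] by metis
  next
    case inside
    \<comment> \<open>As \<open>\<beta>\<close> vanishes at \<open>i\<close> and \<open>j\<close>,
      \<open>\<alpha> + \<beta>\<close> has the same values there as \<open>\<alpha>\<close>, and
      the exchange can be made in \<open>V\<close>.\<close>
    then have 0: "lookup \<beta> i = 0" "lookup \<beta> j = 0" using \<beta>(1) by (auto simp: hit_def)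
    then have "\<alpha> + \<beta> + Poly_Mapping.single i 1 - Poly_Mapping.single j 1 \<in> V"
      using V(3) \<beta>(2) less by (simp add: exchange_def lookup_add)
    also have "\<alpha> + \<beta> + Poly_Mapping.single i 1 - Poly_Mapping.single j 1 = ?\<alpha>' + \<beta>"
      by (rule poly_mapping_eqI)
        (use 0 less in \<open>auto simp: lookup_add lookup_minus lookup_single when_def\<close>)
    finally show ?thesis using \<beta>(1) by blast
  next
    case mixed
    \<comment> \<open>The transposition replaces \<open>j\<close> by \<open>i\<close> in
      \<open>F\<close>. Thus \<open>\<epsilon>\<close> vanishes at \<open>i\<close> and on
      \<open>F\<close> except possibly at \<open>j\<close>.\<close>
    have "transpose i j ` F \<in> \<F>" using \<F>[OF F] by simp
    then obtain \<epsilon> where \<epsilon>: "\<epsilon> \<notin> hit (transpose i j ` F)" "\<alpha> + \<epsilon> \<in> V"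
      using \<alpha> by (auto simp: sat_def)
    have \<epsilon>0: "lookup \<epsilon> (transpose i j k) = 0" if "k \<in> F" for k
      using \<epsilon>(1) that by (auto simp: hit_def)
    have i0: "lookup \<epsilon> i = 0" using \<epsilon>0[OF mixed(2)] by simp
    let ?e = "lookup \<epsilon> j"
    \<comment> \<open>The whole surplus \<open>?e\<close> of \<open>\<epsilon>\<close> at
      \<open>j\<close> and one unit of \<open>\<alpha>\<close> are moved to \<open>i\<close>. This
      many units are allowed because \<open>\<epsilon>\<close> vanishes at \<open>i\<close> and
      \<open>\<alpha>\<close> is smaller at \<open>i\<close> than at \<open>j\<close>. The remaining
      shift avoids \<open>F\<close>, since \<open>i\<close> lies outside \<open>F\<close>.\<close>
    have "\<alpha> + \<epsilon> + Poly_Mapping.single i (?e + 1) - Poly_Mapping.single j (?e + 1) \<in> V"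
      by (rule exchange_multiple[OF V(3,2) \<epsilon>(2)]) (use less i0 in \<open>simp add: lookup_add\<close>)
    also have "\<alpha> + \<epsilon> + Poly_Mapping.single i (?e + 1) - Poly_Mapping.single j (?e + 1) =
        ?\<alpha>' + (\<epsilon> + Poly_Mapping.single i ?e - Poly_Mapping.single j ?e)"
      by (rule poly_mapping_eqI)
        (use ij less in \<open>auto simp: lookup_add lookup_minus lookup_single when_def\<close>)
    finally have "?\<alpha>' + (\<epsilon> + Poly_Mapping.single i ?e - Poly_Mapping.single j ?e) \<in> V" .
    moreover have "\<epsilon> + Poly_Mapping.single i ?e - Poly_Mapping.single j ?e \<notin> hit F"
    proof -
      have "lookup (\<epsilon> + Poly_Mapping.single i ?e - Poly_Mapping.single j ?e) k = 0" if "k \<in> F" for k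
        using \<epsilon>0[OF that] that mixed ij
        by (cases "k = j") (auto simp: lookup_add lookup_minus lookup_single when_def transpose_def split: if_splits)
      then show ?thesis by (simp add: hit_def)
    qed
    ultimately show ?thesis by blast
  qed
  then show "?\<alpha>' \<in> sat F V" by (simp add: sat_def)
qed

section \<open>Symmetric strongly shifted ideals and their symbolic powers\<close>

lemma symmetric_strongly_shifted_mon_span_iff:
  fixes U :: "('n::{finite, linorder} \<Rightarrow>\<^sub>0 nat) set"
  assumes up: "up_closed U"
  shows "symmetric_strongly_shifted (mon_span U :: ('n, 'k::field) mpol set) \<longleftrightarrow>
    0 \<notin> U \<and> perm_closed U \<and> exchange U"
proof -
  have "mon_span U = (UNIV :: ('n, 'k) mpol set) \<longleftrightarrow> U = UNIV"
  proof -
    have "(UNIV :: ('n, 'k) mpol set) = mon_span UNIV" by (simp add: mon_span_def)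
    then show ?thesis by (metis mon_span_eq_iff)
  qed
  also have "\<dots> \<longleftrightarrow> 0 \<in> U"
  proof
    assume "0 \<in> U"
    then have "\<alpha> \<in> U" for \<alpha> using up_closedD[OF up, of 0 \<alpha>] by simp
    then show "U = UNIV" by blast
  qed simp
  finally have proper: "mon_span U = (UNIV :: ('n, 'k) mpol set) \<longleftrightarrow> 0 \<in> U" .
  have mono: "monomial_ideal (mon_span U :: ('n, 'k) mpol set)"
    using up by (auto simp: monomial_ideal_iff)
  show ?thesis
  proof
    assume L: "symmetric_strongly_shifted (mon_span U :: ('n, 'k) mpol set)"
    then have "perm_closed U" by (simp add: symmetric_strongly_shifted_def sym_fixed_mon_span)
    moreover from this have "exchange U"
      by (rule exchange_if_sorted_exchange)
        (use L in \<open>auto simp: symmetric_strongly_shifted_def P_of_def\<close>)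
    ultimately show "0 \<notin> U \<and> perm_closed U \<and> exchange U"
      using L proper by (auto simp: symmetric_strongly_shifted_def)
  next
    assume "0 \<notin> U \<and> perm_closed U \<and> exchange U"
    then show "symmetric_strongly_shifted (mon_span U :: ('n, 'k) mpol set)"
      using mono proper
      by (auto simp: symmetric_strongly_shifted_def sym_fixed_mon_span P_of_def exchange_def)
  qed
qed

text \<open>The member \<open>F\<close> with \<open>V \<subseteq> hit F\<close> supplies properness:
  a shift taking \<open>0\<close> into \<open>V\<close> would have to meet \<open>F\<close> and
  avoid it.\<close>

lemma symmetric_strongly_shifted_INT_local_contraction:
  fixes V :: "('n::{finite, linorder} \<Rightarrow>\<^sub>0 nat) set"
  assumes V: "up_closed V" "perm_closed V" "exchange V"
    and \<F>: "\<And>F \<sigma>. F \<in> \<F> \<Longrightarrow> bij \<sigma> \<Longrightarrow> \<sigma> ` F \<in> \<F>"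
    and F: "F \<in> \<F>" "V \<subseteq> hit F"
  shows "symmetric_strongly_shifted
    (\<Inter>F\<in>\<F>. local_contraction (mon_span (hit F)) (mon_span V :: ('n, 'k::field) mpol set))"
proof -
  have "(\<Inter>F\<in>\<F>. local_contraction (mon_span (hit F)) (mon_span V)) =
      (mon_span (\<Inter>F\<in>\<F>. sat F V) :: ('n, 'k) mpol set)"
    by (simp add: local_contraction_mon_span[OF V(1)]) (auto simp: mon_span_def)
  moreover have "0 \<notin> (\<Inter>F\<in>\<F>. sat F V)"
  proof -
    have "0 \<notin> sat F V" using F(2) by (auto simp: sat_def)
    then show ?thesis using F(1) by blast
  qed
  ultimately show ?thesis
    using symmetric_strongly_shifted_mon_span_iff[OF up_closed_INT_sat[OF V(1)]]
      perm_closed_INT_sat[OF V(2) \<F>] exchange_INT_sat[OF V \<F>] by metis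
qed

theorem proposition2p13:
  fixes I :: "('n::{finite, linorder}, 'k::field) mpol set" and m :: nat
  assumes "symmetric_strongly_shifted I" and "m \<ge> 1"
  shows "symmetric_strongly_shifted (symbolic_power_Min I m) \<and>
         symmetric_strongly_shifted (symbolic_power_Ass I m)"
proof -
  from assms(1) obtain U where U: "up_closed U" and I: "I = mon_span U"
    by (auto simp: symmetric_strongly_shifted_def monomial_ideal_iff)
  from assms(1) have 0: "0 \<notin> U" and perm: "perm_closed U" and exch: "exchange U"
    unfolding I symmetric_strongly_shifted_mon_span_iff[OF U] by auto
  obtain V where power: "I [^]\<^bsub>ideals_set ring_of_type_algebra\<^esub> m = mon_span V"
    and V: "up_closed V" "perm_closed V" "exchange V" and "V \<subseteq> U"
    using ideal_power_mon_span[OF U perm exch, of m, where ?'k = 'k] assms(2) unfolding I by blast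
  define Min where "Min = {F. U \<subseteq> hit F \<and> (\<forall>G. G \<subset> F \<longrightarrow> \<not> U \<subseteq> hit G)}"
  define Ass where "Ass = {F. \<exists>\<alpha>. \<forall>\<beta>. \<alpha> + \<beta> \<in> U \<longleftrightarrow> \<beta> \<in> hit F}"
  \<comment> \<open>Properness of \<open>I\<close> makes the set of all variables a transversal; by
    finiteness there is then a minimal one.\<close>
  have "U \<subseteq> hit UNIV"
  proof
    fix \<alpha> assume "\<alpha> \<in> U"
    then have "\<alpha> \<noteq> 0" using 0 by auto
    then show "\<alpha> \<in> hit UNIV" unfolding hit_def by (metis (mono_tags, lifting) CollectI UNIV_I lookup_zero poly_mapping_eqI)
  qed
  then have "{F. U \<subseteq> hit F} \<noteq> {}" by blast
  then obtain F where F: "U \<subseteq> hit F" "\<And>G. G \<subset> F \<Longrightarrow> \<not> U \<subseteq> hit G"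
    using finite_has_minimal[of "{F. U \<subseteq> hit F}"] by (metis finite mem_Collect_eq psubsetE psubset_imp_subset)
  then have "F \<in> Min" by (simp add: Min_def)
  \<comment> \<open>The same \<open>F\<close> belongs to both families, so it gives properness of
    both symbolic powers.\<close>
  have "F \<in> Ass" using minimal_transversal_witness[OF U F] by (simp add: Ass_def)
  have "V \<subseteq> hit F" using \<open>V \<subseteq> U\<close> F by blast
  have Min: "\<sigma> ` F \<in> Min" if "F \<in> Min" "bij \<sigma>" for F \<sigma>
  proof -
    from that have F: "U \<subseteq> hit F" "\<And>G. G \<subset> F \<Longrightarrow> \<not> U \<subseteq> hit G" by (simp_all add: Min_def)
    have "U \<subseteq> hit (\<sigma> ` F)" using perm \<open>bij \<sigma>\<close> F(1) by (rule subset_hit_image)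
    moreover have "\<not> U \<subseteq> hit G" if "G \<subset> \<sigma> ` F" for G
      using perm \<open>bij \<sigma>\<close> F that by (rule minimal_transversal_image)
    ultimately show ?thesis by (simp add: Min_def)
  qed
  have Ass: "\<sigma> ` F \<in> Ass" if "F \<in> Ass" and \<sigma>: "bij \<sigma>" for F \<sigma>
  proof -
    from \<open>F \<in> Ass\<close> obtain \<alpha> where \<alpha>: "\<And>\<beta>. \<alpha> + \<beta> \<in> U \<longleftrightarrow> \<beta> \<in> hit F" by (auto simp: Ass_def)
    \<comment> \<open>The witness for \<open>F\<close>, permuted along with \<open>F\<close>, is a
      witness for the image of \<open>F\<close>.\<close>
    have "Poly_Mapping.map_key (inv_into UNIV \<sigma>) \<alpha> + \<beta> \<in> U \<longleftrightarrow> \<beta> \<in> hit (\<sigma> ` F)" for \<beta>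
    proof -
      have "Poly_Mapping.map_key (inv_into UNIV \<sigma>) \<alpha> + \<beta> \<in> U \<longleftrightarrow> \<alpha> + Poly_Mapping.map_key \<sigma> \<beta> \<in> U"
        using perm_closed_iff[OF perm \<sigma>, of "Poly_Mapping.map_key (inv_into UNIV \<sigma>) \<alpha> + \<beta>"]
        by (simp add: map_key_plus[OF bij_is_inj[OF \<sigma>]] map_key_inv_map_key[OF \<sigma>])
      then show ?thesis by (simp add: \<alpha> map_key_in_hit_iff[OF bij_is_inj[OF \<sigma>]])
    qed
    then show ?thesis by (auto simp: Ass_def)
  qed
  have "symbolic_power_Min I m = (\<Inter>F\<in>Min. local_contraction (mon_span (hit F)) (mon_span V))"
    unfolding symbolic_power_Min_def power unfolding I min_primes_mon_span Min_def by blast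
  moreover have "symbolic_power_Ass I m = (\<Inter>F\<in>Ass. local_contraction (mon_span (hit F)) (mon_span V))"
    unfolding symbolic_power_Ass_def power unfolding I ass_primes_mon_span[OF U] Ass_def by blast
  ultimately show ?thesis
    using symmetric_strongly_shifted_INT_local_contraction[OF V Min \<open>F \<in> Min\<close> \<open>V \<subseteq> hit F\<close>]
      symmetric_strongly_shifted_INT_local_contraction[OF V Ass \<open>F \<in> Ass\<close> \<open>V \<subseteq> hit F\<close>] by simp
qed

end
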